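(* Let $(\mathfrak{g},[\cdot,\cdot],\delta_\mathfrak{g})$ be a Lie bialgebra over $k$, $E$ a vector space containing $\mathfrak{g}$ as a subspace and $V$ a complement of $\mathfrak{g}$ in $E$. Put $\mathcal{HBI}^2_\mathfrak{g}(V,\mathfrak{g}):=\mathcal{LBI}(\mathfrak{g},V)/\equiv$. Then the map $$\mathcal{HBI}^2_\mathfrak{g}(V,\mathfrak{g})\to BExtd(E,\mathfrak{g}),$$ sending the equivalence class of a Lie bialgebraic extending structure $\Omega^{bi}(\mathfrak{g},V)$ to the equivalence class of the unified bi-product $\mathfrak{g}\natural^{bi}V$ (a Lie bialgebra structure on $E=\mathfrak{g}\oplus V$), is bijective.
   Context: $k$ is a field of characteristic $0$; all vector spaces and (multi)linear maps are over $k$. $I$ denotes the identity map. A Lie coalgebra $(\mathfrak{g},\delta_\mathfrak{g})$ is a vector space with a linear map $\delta_\mathfrak{g}:\mathfrak{g}\to\mathfrak{g}\otimes\mathfrak{g}$ such that $\delta_\mathfrak{g}=-\tau\delta_\mathfrak{g}$ and $(I\otimes\delta_\mathfrak{g})\delta_\mathfrak{g}-\tau_{12}(I\otimes\delta_\mathfrak{g})\delta_\mathfrak{g}=(\delta_\mathfrak{g}\otimes I)\delta_\mathfrak{g}$, where $\tau(a\otimes b)=b\otimes a$, $\tau_{12}(a\otimes b\otimes c)=b\otimes a\otimes c$. A Lie bialgebra $(\mathfrak{g},[\cdot,\cdot],\delta_\mathfrak{g})$ is a Lie algebra that is also a Lie coalgebra, with $\delta_\mathfrak{g}([a,b])=a.\delta_\mathfrak{g}(b)-b.\delta_\mathfrak{g}(a)$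 for all $a,b$, where $a.(b\otimes c)=[a,b]\otimes c+b\otimes[a,c]$. Homomorphisms of Lie bialgebras are linear maps that are both Lie algebra and Lie coalgebra homomorphisms ($\delta\varphi=(\varphi\otimes\varphi)\delta$). A Lie sub-bialgebra is a subspace $\mathfrak{g}\subseteq E$ with a Lie bialgebra structure such that the bracket and co-bracket of $E$ restrict to those of $\mathfrak{g}$. $BExtd(E,\mathfrak{g})$: the set of equivalence classes of Lie bialgebra structures on $E$ containing $(\mathfrak{g},[\cdot,\cdot],\delta_\mathfrak{g})$ as a Lie sub-bialgebra, two such structures being equivalent if there is an isomorphism of Lie bialgebras between them whose restriction to $\mathfrak{g}$ is the identity. An extending datum of $(\mathfrak{g},[\cdot,\cdot],\delta_\mathfrak{g})$ by $V$ is a system $\Omega^{bi}(\mathfrak{g},V)=(\lhd,\rhd,f,\{\cdot,\cdot\},\Delta_E,\Delta_V,\delta_V)$ of bilinear maps $\lhd:V\times\mathfrak{g}\to V$, $\rhd:V\times\mathfrak{g}\to\mathfrak{g}$, $f:V\times V\to\mathfrak{g}$, $\{\cdot,\cdot\}:V\times V\to V$ and linear maps $\Delta_E:V\to\mathfrak{g}\otimes V$, $\Delta_V:V\to\mathfrak{g}\otimes\mathfrak{g}$, $\delta_V:V\to V\otimes V$. Given such a datum, $\mathfrak{g}\natural^{bi}V$ denotes the vector space $\mathfrak{g}\oplus V$ with $[a+x,b+y]=[a,b]+x\rhd b-y\rhd a+f(x,y)+x\lhd b-y\lhd a+\{x,y\}$ and $\delta_E(a+x)=\delta_\mathfrak{g}(a)+\Delta_E(x)-\tau\Delta_E(x)+\Delta_V(x)+\delta_V(x)$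 for $a,b\in\mathfrak{g}$, $x,y\in V$. If this is a Lie bialgebra, $\mathfrak{g}\natural^{bi}V$ is called the unified bi-product and the datum is called a Lie bialgebraic extending structure of $(\mathfrak{g},[\cdot,\cdot],\delta_\mathfrak{g})$ by $V$. $\mathcal{LBI}(\mathfrak{g},V)$ is the set of all of these. Two elements $(\lhd,\rhd,f,\{\cdot,\cdot\},\Delta_E,\Delta_V,\delta_V)$ and $(\lhd',\rhd',f',\{\cdot,\cdot\}',\Delta_E',\Delta_V',\delta_V')$ of $\mathcal{LBI}(\mathfrak{g},V)$ are equivalent ($\equiv$) if there are a linear map $p:V\to\mathfrak{g}$ and a linear automorphism $q$ of $V$ such that for all $a\in\mathfrak{g}$, $x,y\in V$, writing $\bar x=q^{-1}(x)$, $\bar y=q^{-1}(y)$: $\delta_V'(x)=(q\otimes q)\delta_V(\bar x)$; $\Delta_E'(x)=(I\otimes q)\Delta_E(\bar x)+(p\otimes q)\delta_V(\bar x)$; $\Delta_V'(x)=(I\otimes p)\Delta_E(\bar x)-(p\otimes I)\tau\Delta_E(\bar x)+(p\otimes p)\delta_V(\bar x)+\Delta_V(\bar x)-\delta_\mathfrak{g}(p(\bar x))$; $x\lhd' a=q(\bar x\lhd a)$; $x\rhd' a=p(\bar x\lhd a)+\bar x\rhd a-[p(\bar x),a]$; $f'(x,y)=f(\bar x,\bar y)+p(\{\bar x,\bar y\})+[p(\bar x),p(\bar y)]-p(\bar x\lhd p(\bar y))-\bar x\rhd p(\bar y)+p(\bar y\lhd p(\bar x))+\bar y\rhd p(\bar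 x)$; $\{x,y\}'=q(\{\bar x,\bar y\})-q(\bar x\lhd p(\bar y))+q(\bar y\lhd p(\bar x))$. *)

theory Defs
  imports Complex_Main "HOL-Library.FuncSet" "HOL-Library.Function_Algebras"
begin

text \<open>
  Subspaces are sets inside an ambient vector space, as in \<^locale>\<open>vector_space\<close>. A map with
  domain a subspace is a function on the ambient type of which only the values on the subspace
  matter.
\<close>

definition linear_on ::
  "('k::field \<Rightarrow> 'a::ab_group_add \<Rightarrow> 'a) \<Rightarrow> ('k \<Rightarrow> 'c::ab_group_add \<Rightarrow> 'c) \<Rightarrow> 'a set \<Rightarrow> ('a \<Rightarrow> 'c) \<Rightarrow> bool"
where
  "linear_on sa sc S f \<longleftrightarrow>
     (\<forall>x\<in>S. \<forall>y\<in>S. f (x + y) = f x + f y) \<and> (\<forall>c. \<forall>x\<in>S. f (sa c x) = sc c (f x))"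

definition bilinear_on ::
  "('k::field \<Rightarrow> 'a::ab_group_add \<Rightarrow> 'a) \<Rightarrow> ('k \<Rightarrow> 'b::ab_group_add \<Rightarrow> 'b) \<Rightarrow>
   ('k \<Rightarrow> 'c::ab_group_add \<Rightarrow> 'c) \<Rightarrow> 'a set \<Rightarrow> 'b set \<Rightarrow> ('a \<Rightarrow> 'b \<Rightarrow> 'c) \<Rightarrow> bool"
where
  "bilinear_on sa sb sc S T b \<longleftrightarrow>
     (\<forall>y\<in>T. linear_on sa sc S (\<lambda>x. b x y)) \<and> (\<forall>x\<in>S. linear_on sb sc T (b x))"


section \<open>Tensor products of vector spaces\<close>

text \<open>
  The tensor product of two vector spaces is realised in the dual of their bilinear forms: the
  pure tensor of \<open>x\<close> and \<open>y\<close> is the evaluation of bilinear forms at \<open>(x, y)\<close>, and the tensor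
  product is the linear span of the pure tensors. For subspaces \<open>S\<close> and \<open>T\<close>, \<open>tensor_space sa sb S T\<close>
  is the tensor product of \<open>S\<close> and \<open>T\<close>, regarded as a subspace of that of the ambient spaces. The
  universal property is proved below (\<open>tensor_lift\<close>, \<open>tensor_lift_unique\<close>).
\<close>

type_synonym ('a, 'b, 'k) tensor = "('a \<Rightarrow> 'b \<Rightarrow> 'k) \<Rightarrow> 'k"

definition tensor_scale :: "'k::field \<Rightarrow> ('a, 'b, 'k) tensor \<Rightarrow> ('a, 'b, 'k) tensor" where
  "tensor_scale c t = (\<lambda>B. c * t B)"

definition pure_tensor ::
  "('k::field \<Rightarrow> 'a::ab_group_add \<Rightarrow> 'a) \<Rightarrow> ('k \<Rightarrow> 'b::ab_group_add \<Rightarrow> 'b) \<Rightarrow> 'a \<Rightarrow> 'b \<Rightarrow> ('a, 'b, 'k) tensor"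
where
  "pure_tensor sa sb x y = (\<lambda>B. if bilinear_on sa sb (*) UNIV UNIV B then B x y else 0)"

definition tensor_space ::
  "('k::field \<Rightarrow> 'a::ab_group_add \<Rightarrow> 'a) \<Rightarrow> ('k \<Rightarrow> 'b::ab_group_add \<Rightarrow> 'b) \<Rightarrow>
   'a set \<Rightarrow> 'b set \<Rightarrow> ('a, 'b, 'k) tensor set"
where
  "tensor_space sa sb S T = module.span tensor_scale {pure_tensor sa sb x y | x y. x \<in> S \<and> y \<in> T}"

text \<open>
  The linear map on the tensor product of \<open>S\<close> and \<open>T\<close> induced by a bilinear map \<open>b\<close> on \<open>S \<times> T\<close>. Its
  values outside \<open>tensor_space sa sb S T\<close> are not determined, and never used.
\<close>

definition tensor_lift ::
  "('k::field \<Rightarrow> 'a::ab_group_add \<Rightarrow> 'a) \<Rightarrow> ('k \<Rightarrow> 'b::ab_group_add \<Rightarrow> 'b) \<Rightarrow>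
   ('k \<Rightarrow> 'c::ab_group_add \<Rightarrow> 'c) \<Rightarrow> 'a set \<Rightarrow> 'b set \<Rightarrow> ('a \<Rightarrow> 'b \<Rightarrow> 'c) \<Rightarrow> ('a, 'b, 'k) tensor \<Rightarrow> 'c"
where
  "tensor_lift sa sb sc S T b =
     (SOME L. Vector_Spaces.linear tensor_scale sc L \<and>
        (\<forall>x\<in>S. \<forall>y\<in>T. L (pure_tensor sa sb x y) = b x y))"

lemma vector_space_tensor_scale:
  "vector_space (tensor_scale :: 'k::field \<Rightarrow> ('a, 'b, 'k) tensor \<Rightarrow> _)"
  by unfold_locales (auto simp: tensor_scale_def fun_eq_iff algebra_simps)

lemma vector_space_field_mult: "vector_space ((*) :: 'k::field \<Rightarrow> 'k \<Rightarrow> 'k)"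
  by unfold_locales (auto simp: algebra_simps)

lemma bilinear_on_pure_tensor:
  fixes sa :: "'k::field \<Rightarrow> 'a::ab_group_add \<Rightarrow> 'a" and sb :: "'k \<Rightarrow> 'b::ab_group_add \<Rightarrow> 'b"
  shows "bilinear_on sa sb tensor_scale UNIV UNIV (pure_tensor sa sb)"
  by (auto simp: bilinear_on_def linear_on_def pure_tensor_def tensor_scale_def fun_eq_iff)

lemma subspace_projection:
  assumes "vector_space s" "module.subspace s S"
  obtains P where "Vector_Spaces.linear s s P" "\<And>x. P x \<in> S" "\<And>x. x \<in> S \<Longrightarrow> P x = x"
proof -
  interpret vector_space s by fact
  interpret pair: vector_space_pair s s by unfold_locales
  obtain B where B: "B \<subseteq> S" "independent B" "S \<subseteq> span B"
    using maximal_independent_subset by blast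
  obtain P where P: "Vector_Spaces.linear s s P" "\<forall>x\<in>B. P x = id x" "range P = span (id ` B)"
    using pair.linear_independent_extend_subspace[OF B(2), of id] by blast
  have "span B \<subseteq> S" using assms(2) B(1) by (simp add: span_minimal)
  with P(3) have 1: "P x \<in> S" for x by auto
  have "P x = id x" if "x \<in> S" for x
    by (rule pair.linear_eq_on[OF P(1) _ _ , of id x B]) (use P B that linear_id in auto)
  with 1 P(1) that show thesis by auto
qed

lemma linear_functional_separates:
  assumes "vector_space (s :: 'k::field \<Rightarrow> 'c::ab_group_add \<Rightarrow> 'c)"
    and eq: "\<And>\<phi>. Vector_Spaces.linear s (*) \<phi> \<Longrightarrow> \<phi> u = \<phi> v"
  shows "u = v"
proof (rule ccontr)
  assume "u \<noteq> v"
  interpret vector_space s by fact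
  interpret pair: vector_space_pair s "(*)"
    unfolding vector_space_pair_def using assms(1) vector_space_field_mult by auto
  have "independent {u - v}" using \<open>u \<noteq> v\<close> by simp
  then obtain \<phi> where l: "Vector_Spaces.linear s (*) \<phi>" and 1: "\<phi> (u - v) = 1"
    using pair.linear_independent_extend[of "{u - v}" "\<lambda>_. 1"] by auto
  interpret \<phi>: Vector_Spaces.linear s "(*)" \<phi> by fact
  from 1 eq[OF l] show False by (simp add: \<phi>.diff)
qed

lemma tensor_lift_exists:
  fixes sa :: "'k::field \<Rightarrow> 'a::ab_group_add \<Rightarrow> 'a" and sb :: "'k \<Rightarrow> 'b::ab_group_add \<Rightarrow> 'b"
    and sc :: "'k \<Rightarrow> 'c::ab_group_add \<Rightarrow> 'c"
  assumes sa: "vector_space sa" and sb: "vector_space sb" and sc: "vector_space sc"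
    and S: "module.subspace sa S" and T: "module.subspace sb T"
    and b: "bilinear_on sa sb sc S T b"
  shows "\<exists>L. Vector_Spaces.linear tensor_scale sc L \<and>
           (\<forall>x\<in>S. \<forall>y\<in>T. L (pure_tensor sa sb x y) = b x y)"
proof -
  obtain P where P: "Vector_Spaces.linear sa sa P" "\<And>x. P x \<in> S" "\<And>x. x \<in> S \<Longrightarrow> P x = x"
    using subspace_projection[OF sa S] by blast
  obtain Q where Q: "Vector_Spaces.linear sb sb Q" "\<And>y. Q y \<in> T" "\<And>y. y \<in> T \<Longrightarrow> Q y = y"
    using subspace_projection[OF sb T] by blast
  define b' where "b' x y = b (P x) (Q y)" for x y
  interpret t: vector_space "tensor_scale :: 'k \<Rightarrow> ('a, 'b, 'k) tensor \<Rightarrow> _"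
    by (rule vector_space_tensor_scale)
  interpret tc: vector_space_pair "tensor_scale :: 'k \<Rightarrow> ('a, 'b, 'k) tensor \<Rightarrow> _" sc
    unfolding vector_space_pair_def using sc vector_space_tensor_scale by auto
  interpret tk: vector_space_pair "tensor_scale :: 'k \<Rightarrow> ('a, 'b, 'k) tensor \<Rightarrow> _" "(*)"
    unfolding vector_space_pair_def using vector_space_field_mult vector_space_tensor_scale by auto
  define R where "R = (\<lambda>(x, y). pure_tensor sa sb x y) ` UNIV"
  obtain B where B: "B \<subseteq> R" "t.independent B" "R \<subseteq> t.span B"
    using t.maximal_independent_subset by blast
  have "\<forall>t\<in>B. \<exists>z. t = pure_tensor sa sb (fst z) (snd z)" using B(1) by (fastforce simp: R_def)
  then obtain z where z: "\<And>t. t \<in> B \<Longrightarrow> t = pure_tensor sa sb (fst (z t)) (snd (z t))" by metis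
  obtain L where L: "Vector_Spaces.linear tensor_scale sc L"
    "\<forall>t\<in>B. L t = b' (fst (z t)) (snd (z t))"
    using tc.linear_independent_extend[OF B(2), of "\<lambda>t. b' (fst (z t)) (snd (z t))"] by blast
  have "L (pure_tensor sa sb x y) = b' x y" for x y
  proof (rule linear_functional_separates[OF sc])
    fix \<phi> assume \<phi>: "Vector_Spaces.linear sc (*) \<phi>"
    define F where "F = (\<lambda>x y. \<phi> (b' x y))"
    have F: "bilinear_on sa sb (*) UNIV UNIV F"
      using P Q \<phi> b unfolding F_def b'_def bilinear_on_def linear_on_def Vector_Spaces.linear_iff
      by simp
    have ev: "Vector_Spaces.linear tensor_scale (*) (\<lambda>t :: ('a, 'b, 'k) tensor. t F)"
      unfolding Vector_Spaces.linear_iff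
      by (simp add: vector_space_tensor_scale vector_space_field_mult tensor_scale_def)
    have \<phi>L: "Vector_Spaces.linear tensor_scale (*) (\<lambda>t. \<phi> (L t))"
      using L(1) \<phi> unfolding Vector_Spaces.linear_iff by simp
    have pt: "pure_tensor sa sb u v F = \<phi> (b' u v)" for u v
      using F by (simp add: pure_tensor_def F_def)
    have "\<phi> (L (pure_tensor sa sb x y)) = pure_tensor sa sb x y F"
    proof (rule tk.linear_eq_on[OF \<phi>L ev])
      show "pure_tensor sa sb x y \<in> t.span B" using B(3) by (auto simp: R_def)
      show "\<phi> (L t) = t F" if "t \<in> B" for t
        using z[OF that] L(2) that pt by metis
    qed
    then show "\<phi> (L (pure_tensor sa sb x y)) = \<phi> (b' x y)" by (simp add: pt)
  qed
  with L(1) P(3) Q(3) show ?thesis by (auto simp: b'_def)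
qed

lemma tensor_lift:
  assumes "vector_space sa" "vector_space sb" "vector_space sc"
    and "module.subspace sa S" "module.subspace sb T" "bilinear_on sa sb sc S T b"
  shows "Vector_Spaces.linear tensor_scale sc (tensor_lift sa sb sc S T b)"
    and "\<And>x y. x \<in> S \<Longrightarrow> y \<in> T \<Longrightarrow> tensor_lift sa sb sc S T b (pure_tensor sa sb x y) = b x y"
  using someI_ex[OF tensor_lift_exists[OF assms]] unfolding tensor_lift_def by auto

lemma tensor_lift_unique:
  assumes "vector_space sa" "vector_space sb" "vector_space sc"
    and "module.subspace sa S" "module.subspace sb T" "bilinear_on sa sb sc S T b"
    and L: "Vector_Spaces.linear tensor_scale sc L"
      "\<And>x y. x \<in> S \<Longrightarrow> y \<in> T \<Longrightarrow> L (pure_tensor sa sb x y) = b x y"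
    and t: "t \<in> tensor_space sa sb S T"
  shows "L t = tensor_lift sa sb sc S T b t"
proof -
  interpret vector_space_pair tensor_scale sc
    unfolding vector_space_pair_def using assms(3) vector_space_tensor_scale by auto
  show ?thesis
    by (rule linear_eq_on[OF L(1) tensor_lift(1)[OF assms(1-6)] t[unfolded tensor_space_def]])
      (use L(2) tensor_lift(2)[OF assms(1-6)] in auto)
qed


section \<open>Lie bialgebras inside an ambient vector space\<close>

type_synonym ('e, 'k) tensor2 = "('e, 'e, 'k) tensor"
type_synonym ('e, 'k) tensor3 = "(('e, 'e, 'k) tensor, 'e, 'k) tensor"

locale vector_space_char_0 = vector_space scale
  for scale :: "'a::field_char_0 \<Rightarrow> 'b::ab_group_add \<Rightarrow> 'b" (infixr \<open>*s\<close> 75)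

context vector_space_char_0
begin

definition pure2 :: "'b \<Rightarrow> 'b \<Rightarrow> ('b, 'a) tensor2" (infixl "\<otimes>" 75) where
  "x \<otimes> y = pure_tensor scale scale x y"

definition tspace :: "'b set \<Rightarrow> 'b set \<Rightarrow> ('b, 'a) tensor2 set" where
  "tspace S T = tensor_space scale scale S T"

definition lift2 ::
  "('a \<Rightarrow> 'c::ab_group_add \<Rightarrow> 'c) \<Rightarrow> 'b set \<Rightarrow> 'b set \<Rightarrow> ('b \<Rightarrow> 'b \<Rightarrow> 'c) \<Rightarrow> ('b, 'a) tensor2 \<Rightarrow> 'c"
where
  "lift2 sc S T b = tensor_lift scale scale sc S T b"

definition tmap :: "'b set \<Rightarrow> 'b set \<Rightarrow> ('b \<Rightarrow> 'b) \<Rightarrow> ('b \<Rightarrow> 'b) \<Rightarrow> ('b, 'a) tensor2 \<Rightarrow> ('b, 'a) tensor2" where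
  "tmap S T \<phi> \<psi> = lift2 tensor_scale S T (\<lambda>x y. \<phi> x \<otimes> \<psi> y)"

definition flip :: "('b, 'a) tensor2 \<Rightarrow> ('b, 'a) tensor2" where
  "flip = lift2 tensor_scale UNIV UNIV (\<lambda>x y. y \<otimes> x)"

text \<open>
  Threefold tensors are bracketed to the left. In \<open>id_tensor_cobracket\<close> the inner lift is the
  reassociated tensor of \<open>x\<close> with \<open>d y\<close>.
\<close>

definition pure3 :: "('b, 'a) tensor2 \<Rightarrow> 'b \<Rightarrow> ('b, 'a) tensor3" where
  "pure3 t z = pure_tensor tensor_scale scale t z"

definition id_tensor_cobracket ::
  "'b set \<Rightarrow> ('b \<Rightarrow> ('b, 'a) tensor2) \<Rightarrow> ('b, 'a) tensor2 \<Rightarrow> ('b, 'a) tensor3"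
where
  "id_tensor_cobracket S d =
     lift2 tensor_scale S S (\<lambda>x y. lift2 tensor_scale S S (\<lambda>u v. pure3 (x \<otimes> u) v) (d y))"

definition cobracket_tensor_id ::
  "'b set \<Rightarrow> ('b \<Rightarrow> ('b, 'a) tensor2) \<Rightarrow> ('b, 'a) tensor2 \<Rightarrow> ('b, 'a) tensor3"
where
  "cobracket_tensor_id S d = lift2 tensor_scale S S (\<lambda>x y. pure3 (d x) y)"

definition flip12 :: "('b, 'a) tensor3 \<Rightarrow> ('b, 'a) tensor3" where
  "flip12 = tensor_lift tensor_scale scale tensor_scale (tspace UNIV UNIV) UNIV
              (\<lambda>t z. pure3 (flip t) z)"

definition lie_algebra_on :: "'b set \<Rightarrow> ('b \<Rightarrow> 'b \<Rightarrow> 'b) \<Rightarrow> bool" where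
  "lie_algebra_on S br \<longleftrightarrow>
     subspace S \<and> br \<in> S \<rightarrow> S \<rightarrow> S \<and> bilinear_on scale scale scale S S br \<and>
     (\<forall>x\<in>S. br x x = 0) \<and>
     (\<forall>x\<in>S. \<forall>y\<in>S. \<forall>z\<in>S. br x (br y z) + br y (br z x) + br z (br x y) = 0)"

definition lie_coalgebra_on :: "'b set \<Rightarrow> ('b \<Rightarrow> ('b, 'a) tensor2) \<Rightarrow> bool" where
  "lie_coalgebra_on S d \<longleftrightarrow>
     subspace S \<and> d \<in> S \<rightarrow> tspace S S \<and> linear_on scale tensor_scale S d \<and>
     (\<forall>x\<in>S. d x = - flip (d x)) \<and>
     (\<forall>x\<in>S. id_tensor_cobracket S d (d x) - flip12 (id_tensor_cobracket S d (d x))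
              = cobracket_tensor_id S d (d x))"

definition lie_act :: "'b set \<Rightarrow> ('b \<Rightarrow> 'b \<Rightarrow> 'b) \<Rightarrow> 'b \<Rightarrow> ('b, 'a) tensor2 \<Rightarrow> ('b, 'a) tensor2" where
  "lie_act S br a = lift2 tensor_scale S S (\<lambda>b c. br a b \<otimes> c + b \<otimes> br a c)"

definition lie_bialgebra_on ::
  "'b set \<Rightarrow> ('b \<Rightarrow> 'b \<Rightarrow> 'b) \<Rightarrow> ('b \<Rightarrow> ('b, 'a) tensor2) \<Rightarrow> bool"
where
  "lie_bialgebra_on S br d \<longleftrightarrow>
     lie_algebra_on S br \<and> lie_coalgebra_on S d \<and>
     (\<forall>a\<in>S. \<forall>b\<in>S. d (br a b) = lie_act S br a (d b) - lie_act S br b (d a))"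

text \<open>\<open>(g, br, d)\<close> is a Lie sub-bialgebra of the ambient space with bracket \<open>B\<close> and co-bracket \<open>D\<close>.\<close>

definition lie_sub_bialgebra ::
  "'b set \<Rightarrow> ('b \<Rightarrow> 'b \<Rightarrow> 'b) \<Rightarrow> ('b \<Rightarrow> ('b, 'a) tensor2) \<Rightarrow>
   ('b \<Rightarrow> 'b \<Rightarrow> 'b) \<Rightarrow> ('b \<Rightarrow> ('b, 'a) tensor2) \<Rightarrow> bool"
where
  "lie_sub_bialgebra g br d B D \<longleftrightarrow>
     lie_bialgebra_on g br d \<and> (\<forall>a\<in>g. \<forall>b\<in>g. B a b = br a b) \<and> (\<forall>a\<in>g. D a = d a)"

definition lie_bialgebra_iso ::
  "('b \<Rightarrow> 'b \<Rightarrow> 'b) \<times> ('b \<Rightarrow> ('b, 'a) tensor2) \<Rightarrow>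
   ('b \<Rightarrow> 'b \<Rightarrow> 'b) \<times> ('b \<Rightarrow> ('b, 'a) tensor2) \<Rightarrow> ('b \<Rightarrow> 'b) \<Rightarrow> bool"
where
  "lie_bialgebra_iso = (\<lambda>(B, D) (B', D') \<phi>.
     Vector_Spaces.linear scale scale \<phi> \<and> bij \<phi> \<and>
     (\<forall>u w. \<phi> (B u w) = B' (\<phi> u) (\<phi> w)) \<and>
     (\<forall>u. D' (\<phi> u) = tmap UNIV UNIV \<phi> \<phi> (D u)))"


section \<open>Extensions of a Lie bialgebra to the ambient space\<close>

definition bialgebra_extensions ::
  "'b set \<Rightarrow> ('b \<Rightarrow> 'b \<Rightarrow> 'b) \<Rightarrow> ('b \<Rightarrow> ('b, 'a) tensor2) \<Rightarrow>
   (('b \<Rightarrow> 'b \<Rightarrow> 'b) \<times> ('b \<Rightarrow> ('b, 'a) tensor2)) set"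
where
  "bialgebra_extensions g br d =
     {(B, D). lie_bialgebra_on UNIV B D \<and> lie_sub_bialgebra g br d B D}"

definition extension_rel ::
  "'b set \<Rightarrow> ('b \<Rightarrow> 'b \<Rightarrow> 'b) \<Rightarrow> ('b \<Rightarrow> ('b, 'a) tensor2) \<Rightarrow>
   (('b \<Rightarrow> 'b \<Rightarrow> 'b) \<times> ('b \<Rightarrow> ('b, 'a) tensor2)) rel"
where
  "extension_rel g br d =
     {(M, M'). M \<in> bialgebra_extensions g br d \<and> M' \<in> bialgebra_extensions g br d \<and>
        (\<exists>\<phi>. lie_bialgebra_iso M M' \<phi> \<and> (\<forall>a\<in>g. \<phi> a = a))}"

definition BExtd ::
  "'b set \<Rightarrow> ('b \<Rightarrow> 'b \<Rightarrow> 'b) \<Rightarrow> ('b \<Rightarrow> ('b, 'a) tensor2) \<Rightarrow>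
   (('b \<Rightarrow> 'b \<Rightarrow> 'b) \<times> ('b \<Rightarrow> ('b, 'a) tensor2)) set set"
where
  "BExtd g br d = bialgebra_extensions g br d // extension_rel g br d"

definition complementary :: "'b set \<Rightarrow> 'b set \<Rightarrow> bool" where
  "complementary g V \<longleftrightarrow>
     subspace g \<and> subspace V \<and> g \<inter> V = {0} \<and> (\<forall>e. \<exists>a\<in>g. \<exists>x\<in>V. e = a + x)"

text \<open>The component in \<open>S\<close> with respect to the decomposition of the ambient space into \<open>S\<close> and \<open>T\<close>.\<close>

definition component :: "'b set \<Rightarrow> 'b set \<Rightarrow> 'b \<Rightarrow> 'b" where
  "component S T e = (THE a. a \<in> S \<and> (\<exists>x\<in>T. e = a + x))"

end


section \<open>Extending structures\<close>

text \<open>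
  The fields are, in this order, the maps
  \<open>\<lhd>\<close>, \<open>\<rhd>\<close>, \<open>f\<close>, \<open>{\<cdot>,\<cdot>}\<close>, \<open>\<Delta>\<^sub>E\<close>, \<open>\<Delta>\<^sub>V\<close>, \<open>\<delta>\<^sub>V\<close>.
\<close>

record ('e, 'k) datum =
  ract :: "'e \<Rightarrow> 'e \<Rightarrow> 'e"
  lact :: "'e \<Rightarrow> 'e \<Rightarrow> 'e"
  cocycle :: "'e \<Rightarrow> 'e \<Rightarrow> 'e"
  vbracket :: "'e \<Rightarrow> 'e \<Rightarrow> 'e"
  Delta_E :: "'e \<Rightarrow> ('e, 'k) tensor2"
  Delta_V :: "'e \<Rightarrow> ('e, 'k) tensor2"
  delta_V :: "'e \<Rightarrow> ('e, 'k) tensor2"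

context vector_space_char_0
begin

text \<open>
  The extensional function spaces fix the values outside the domains, so that records are equal
  exactly when they represent the same system of maps.
\<close>

definition extending_datum :: "'b set \<Rightarrow> 'b set \<Rightarrow> ('b, 'a) datum \<Rightarrow> bool" where
  "extending_datum g V \<Omega> \<longleftrightarrow>
     ract \<Omega> \<in> V \<rightarrow>\<^sub>E g \<rightarrow>\<^sub>E V \<and> bilinear_on scale scale scale V g (ract \<Omega>) \<and>
     lact \<Omega> \<in> V \<rightarrow>\<^sub>E g \<rightarrow>\<^sub>E g \<and> bilinear_on scale scale scale V g (lact \<Omega>) \<and>
     cocycle \<Omega> \<in> V \<rightarrow>\<^sub>E V \<rightarrow>\<^sub>E g \<and> bilinear_on scale scale scale V V (cocycle \<Omega>) \<and>
     vbracket \<Omega> \<in> V \<rightarrow>\<^sub>E V \<rightarrow>\<^sub>E V \<and> bilinear_on scale scale scale V V (vbracket \<Omega>) \<and>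
     Delta_E \<Omega> \<in> V \<rightarrow>\<^sub>E tspace g V \<and> linear_on scale tensor_scale V (Delta_E \<Omega>) \<and>
     Delta_V \<Omega> \<in> V \<rightarrow>\<^sub>E tspace g g \<and> linear_on scale tensor_scale V (Delta_V \<Omega>) \<and>
     delta_V \<Omega> \<in> V \<rightarrow>\<^sub>E tspace V V \<and> linear_on scale tensor_scale V (delta_V \<Omega>)"

definition unified_bracket ::
  "'b set \<Rightarrow> 'b set \<Rightarrow> ('b \<Rightarrow> 'b \<Rightarrow> 'b) \<Rightarrow> ('b, 'a) datum \<Rightarrow> 'b \<Rightarrow> 'b \<Rightarrow> 'b"
where
  "unified_bracket g V br \<Omega> u w =
     (let a = component g V u; x = component V g u; b = component g V w; y = component V g w
      in br a b + lact \<Omega> x b - lact \<Omega> y a + cocycle \<Omega> x y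
           + ract \<Omega> x b - ract \<Omega> y a + vbracket \<Omega> x y)"

definition unified_cobracket ::
  "'b set \<Rightarrow> 'b set \<Rightarrow> ('b \<Rightarrow> ('b, 'a) tensor2) \<Rightarrow> ('b, 'a) datum \<Rightarrow> 'b \<Rightarrow> ('b, 'a) tensor2"
where
  "unified_cobracket g V d \<Omega> u =
     (let a = component g V u; x = component V g u
      in d a + Delta_E \<Omega> x - flip (Delta_E \<Omega> x) + Delta_V \<Omega> x + delta_V \<Omega> x)"

definition unified_biproduct ::
  "'b set \<Rightarrow> 'b set \<Rightarrow> ('b \<Rightarrow> 'b \<Rightarrow> 'b) \<Rightarrow> ('b \<Rightarrow> ('b, 'a) tensor2) \<Rightarrow> ('b, 'a) datum \<Rightarrow>
   ('b \<Rightarrow> 'b \<Rightarrow> 'b) \<times> ('b \<Rightarrow> ('b, 'a) tensor2)"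
where
  "unified_biproduct g V br d \<Omega> = (unified_bracket g V br \<Omega>, unified_cobracket g V d \<Omega>)"

definition LBI ::
  "'b set \<Rightarrow> 'b set \<Rightarrow> ('b \<Rightarrow> 'b \<Rightarrow> 'b) \<Rightarrow> ('b \<Rightarrow> ('b, 'a) tensor2) \<Rightarrow> ('b, 'a) datum set"
where
  "LBI g V br d =
     {\<Omega>. extending_datum g V \<Omega> \<and>
          lie_bialgebra_on UNIV (unified_bracket g V br \<Omega>) (unified_cobracket g V d \<Omega>)}"

definition datum_equiv_via ::
  "'b set \<Rightarrow> 'b set \<Rightarrow> ('b \<Rightarrow> 'b \<Rightarrow> 'b) \<Rightarrow> ('b \<Rightarrow> ('b, 'a) tensor2) \<Rightarrow>
   ('b \<Rightarrow> 'b) \<Rightarrow> ('b \<Rightarrow> 'b) \<Rightarrow> ('b, 'a) datum \<Rightarrow> ('b, 'a) datum \<Rightarrow> bool"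
where
  "datum_equiv_via g V br d p q \<Omega> \<Omega>' \<longleftrightarrow>
     (\<forall>x\<in>V. let x' = inv_into V q x in
        delta_V \<Omega>' x = tmap V V q q (delta_V \<Omega> x') \<and>
        Delta_E \<Omega>' x = tmap g V id q (Delta_E \<Omega> x') + tmap V V p q (delta_V \<Omega> x') \<and>
        Delta_V \<Omega>' x = tmap g V id p (Delta_E \<Omega> x') - tmap V g p id (flip (Delta_E \<Omega> x'))
          + tmap V V p p (delta_V \<Omega> x') + Delta_V \<Omega> x' - d (p x')) \<and>
     (\<forall>x\<in>V. \<forall>a\<in>g. let x' = inv_into V q x in
        ract \<Omega>' x a = q (ract \<Omega> x' a) \<and>
        lact \<Omega>' x a = p (ract \<Omega> x' a) + lact \<Omega> x' a - br (p x') a) \<and>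
     (\<forall>x\<in>V. \<forall>y\<in>V. let x' = inv_into V q x; y' = inv_into V q y in
        cocycle \<Omega>' x y = cocycle \<Omega> x' y' + p (vbracket \<Omega> x' y') + br (p x') (p y')
          - p (ract \<Omega> x' (p y')) - lact \<Omega> x' (p y')
          + p (ract \<Omega> y' (p x')) + lact \<Omega> y' (p x') \<and>
        vbracket \<Omega>' x y = q (vbracket \<Omega> x' y') - q (ract \<Omega> x' (p y')) + q (ract \<Omega> y' (p x')))"

definition datum_rel ::
  "'b set \<Rightarrow> 'b set \<Rightarrow> ('b \<Rightarrow> 'b \<Rightarrow> 'b) \<Rightarrow> ('b \<Rightarrow> ('b, 'a) tensor2) \<Rightarrow> ('b, 'a) datum rel"
where
  "datum_rel g V br d =
     {(\<Omega>, \<Omega>'). \<Omega> \<in> LBI g V br d \<and> \<Omega>' \<in> LBI g V br d \<and>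
        (\<exists>p q. p \<in> V \<rightarrow> g \<and> linear_on scale scale V p \<and>
               linear_on scale scale V q \<and> bij_betw q V V \<and>
               datum_equiv_via g V br d p q \<Omega> \<Omega>')}"

definition HBI ::
  "'b set \<Rightarrow> 'b set \<Rightarrow> ('b \<Rightarrow> 'b \<Rightarrow> 'b) \<Rightarrow> ('b \<Rightarrow> ('b, 'a) tensor2) \<Rightarrow> ('b, 'a) datum set set"
where
  "HBI g V br d = LBI g V br d // datum_rel g V br d"

end

end

theory Submission
  imports Defs
begin

text \<open>
  Projecting bracket and co-bracket onto the blocks of \<open>E = g \<oplus> V\<close> recovers the datum, so the
  bi-product is already a bijection from \<open>LBI\<close> onto the extensions, before passing to classes. A
  linear endomorphism \<open>\<phi>\<close> of \<open>E\<close> fixing \<open>g\<close> is the same as a pair \<open>(p, q)\<close> with \<open>\<phi> x = p x + q x\<close> on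
  \<open>V\<close>; it is bijective iff \<open>q\<close> is, and comparing blocks turns the homomorphism equations for \<open>\<phi>\<close> into the
  defining equations of \<open>\<equiv>\<close>. Hence the two relations correspond under the bijection, and taking
  images of classes is a bijection between the quotients.
\<close>

section \<open>Tensor products of linear maps\<close>

context vector_space_char_0
begin

abbreviation endo_linear :: "('b \<Rightarrow> 'b) \<Rightarrow> bool" where
  "endo_linear \<equiv> Vector_Spaces.linear scale scale"

abbreviation tensor_linear :: "(('b, 'a) tensor2 \<Rightarrow> ('b, 'a) tensor2) \<Rightarrow> bool" where
  "tensor_linear \<equiv> Vector_Spaces.linear tensor_scale tensor_scale"

lemma linear_on_UNIV_iff: "linear_on scale scale UNIV F \<longleftrightarrow> endo_linear F"
  by (auto simp: linear_on_def Vector_Spaces.linear_iff vector_space_axioms)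

lemma tensor_linearD:
  assumes "tensor_linear L"
  shows "L (s + t) = L s + L t" "L (tensor_scale c t) = tensor_scale c (L t)"
    "L (s - t) = L s - L t" "L (- t) = - L t" "L 0 = 0"
proof -
  interpret Vector_Spaces.linear tensor_scale tensor_scale L by fact
  show "L (s + t) = L s + L t" "L (tensor_scale c t) = tensor_scale c (L t)"
    "L (s - t) = L s - L t" "L (- t) = - L t" "L 0 = 0"
    by (simp_all add: add scale diff neg)
qed

lemma tensor_linear_id: "tensor_linear id"
  by (simp add: Vector_Spaces.linear_iff vector_space_tensor_scale)

lemma tensor_linear_zero: "tensor_linear (\<lambda>t. 0)"
  by (simp add: Vector_Spaces.linear_iff vector_space_tensor_scale tensor_scale_def fun_eq_iff)

lemma tensor_linear_comp:
  assumes "tensor_linear L"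
    "tensor_linear L'"
  shows "tensor_linear (L \<circ> L')"
  using assms by (simp add: Vector_Spaces.linear_iff)

lemma tensor_linear_add:
  assumes "tensor_linear L"
    "tensor_linear L'"
  shows "tensor_linear (\<lambda>t. L t + L' t)"
proof -
  interpret t: vector_space "tensor_scale :: 'a \<Rightarrow> ('b, 'a) tensor2 \<Rightarrow> _"
    by (rule vector_space_tensor_scale)
  from assms show ?thesis by (simp add: Vector_Spaces.linear_iff t.scale_right_distrib)
qed

lemma pure2_bilinear: "bilinear_on scale scale tensor_scale UNIV UNIV (\<otimes>)"
  using bilinear_on_pure_tensor[of scale scale] by (simp add: pure2_def[abs_def])

lemma pure2_simps:
  "(x + x') \<otimes> y = x \<otimes> y + x' \<otimes> y" "x \<otimes> (y + y') = x \<otimes> y + x \<otimes> y'"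
  "(c *s x) \<otimes> y = tensor_scale c (x \<otimes> y)" "x \<otimes> (c *s y) = tensor_scale c (x \<otimes> y)"
  using pure2_bilinear by (simp_all add: bilinear_on_def linear_on_def)

lemma pure2_zero [simp]: "0 \<otimes> y = 0" "x \<otimes> 0 = 0"
  using pure2_simps(1)[of 0 0 y] pure2_simps(2)[of x 0 0] by simp_all

lemma tspace_span: "tspace S T = module.span tensor_scale {x \<otimes> y | x y. x \<in> S \<and> y \<in> T}"
  by (simp add: tspace_def tensor_space_def pure2_def)

lemma pure2_in_tspace: "x \<in> S \<Longrightarrow> y \<in> T \<Longrightarrow> x \<otimes> y \<in> tspace S T"
proof -
  interpret t: vector_space "tensor_scale :: 'a \<Rightarrow> ('b, 'a) tensor2 \<Rightarrow> _"
    by (rule vector_space_tensor_scale)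
  show "x \<in> S \<Longrightarrow> y \<in> T \<Longrightarrow> x \<otimes> y \<in> tspace S T"
    unfolding tspace_span by (rule t.span_base) auto
qed

lemma tspace_subspace: "module.subspace tensor_scale (tspace S T)"
proof -
  interpret t: vector_space "tensor_scale :: 'a \<Rightarrow> ('b, 'a) tensor2 \<Rightarrow> _"
    by (rule vector_space_tensor_scale)
  show ?thesis unfolding tspace_span by (rule t.subspace_span)
qed

lemma tspace_mono: "S \<subseteq> S' \<Longrightarrow> T \<subseteq> T' \<Longrightarrow> t \<in> tspace S T \<Longrightarrow> t \<in> tspace S' T'"
proof -
  interpret t: vector_space "tensor_scale :: 'a \<Rightarrow> ('b, 'a) tensor2 \<Rightarrow> _"
    by (rule vector_space_tensor_scale)
  show "S \<subseteq> S' \<Longrightarrow> T \<subseteq> T' \<Longrightarrow> t \<in> tspace S T \<Longrightarrow> t \<in> tspace S' T'"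
    unfolding tspace_span by (erule subsetD[rotated], rule t.span_mono) auto
qed

lemma tspace_UNIV: "t \<in> tspace S T \<Longrightarrow> t \<in> tspace UNIV UNIV"
  by (erule tspace_mono[rotated 2]) auto

lemma tensor_eqI:
  assumes "tensor_linear L"
    "tensor_linear L'"
    "\<And>x y. x \<in> S \<Longrightarrow> y \<in> T \<Longrightarrow> L (x \<otimes> y) = L' (x \<otimes> y)"
    "t \<in> tspace S T"
  shows "L t = L' t"
proof -
  interpret vector_space_pair "tensor_scale :: 'a \<Rightarrow> ('b, 'a) tensor2 \<Rightarrow> _"
    "tensor_scale :: 'a \<Rightarrow> ('b, 'a) tensor2 \<Rightarrow> _"
    unfolding vector_space_pair_def using vector_space_tensor_scale by auto
  show ?thesis
    by (rule linear_eq_on[OF assms(1,2) assms(4)[unfolded tspace_span]]) (use assms(3) in auto)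
qed

text \<open>\<open>tmap\<close> is a chosen linear extension, so linearity and its values on pure
  tensors from \<open>S\<close> and \<open>T\<close> are all that the universal property of
  \<open>tensor_lift\<close> determines.\<close>

lemma
  assumes "subspace S" "subspace T" "linear_on scale scale S \<phi>" "linear_on scale scale T \<psi>"
  shows tmap_linear: "tensor_linear (tmap S T \<phi> \<psi>)"
    and tmap_pure: "\<And>x y. x \<in> S \<Longrightarrow> y \<in> T \<Longrightarrow> tmap S T \<phi> \<psi> (x \<otimes> y) = \<phi> x \<otimes> \<psi> y"
proof -
  have b: "bilinear_on scale scale tensor_scale S T (\<lambda>x y. \<phi> x \<otimes> \<psi> y)"
    using assms(3,4) by (simp add: bilinear_on_def linear_on_def pure2_simps)
  note l = tensor_lift[OF vector_space_axioms vector_space_axioms vector_space_tensor_scale assms(1,2) b]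
  show "tensor_linear (tmap S T \<phi> \<psi>)"
    unfolding tmap_def lift2_def by (rule l)
  show "\<And>x y. x \<in> S \<Longrightarrow> y \<in> T \<Longrightarrow> tmap S T \<phi> \<psi> (x \<otimes> y) = \<phi> x \<otimes> \<psi> y"
    using l(2) unfolding tmap_def lift2_def by (simp add: pure2_def)
qed

lemma flip_linear: "tensor_linear flip"
    and flip_pure [simp]: "flip (x \<otimes> y) = y \<otimes> x"
proof -
  have b: "bilinear_on scale scale tensor_scale UNIV UNIV (\<lambda>x y. y \<otimes> x)"
    by (simp add: bilinear_on_def linear_on_def pure2_simps)
  note l = tensor_lift[OF vector_space_axioms vector_space_axioms vector_space_tensor_scale
      subspace_UNIV subspace_UNIV b]
  show "tensor_linear flip"
    unfolding flip_def lift2_def by (rule l)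
  show "flip (x \<otimes> y) = y \<otimes> x"
    using l(2) unfolding flip_def lift2_def by (simp add: pure2_def)
qed

lemma flip_in_tspace: "t \<in> tspace S T \<Longrightarrow> flip t \<in> tspace T S"
proof -
  interpret L: Vector_Spaces.linear tensor_scale tensor_scale flip
    by (rule flip_linear)
  assume "t \<in> tspace S T"
  then have "t \<in> {t. flip t \<in> tspace T S}"
    unfolding tspace_span[of S T]
    by (rule L.vs1.span_induct)
      (use tspace_subspace in \<open>auto simp: pure2_in_tspace
        intro!: L.subspace_vimage[unfolded vimage_def]\<close>)
  then show ?thesis by simp
qed

lemmas flip_simps = tensor_linearD[OF flip_linear]

abbreviation tensor_map :: "('b \<Rightarrow> 'b) \<Rightarrow> ('b \<Rightarrow> 'b) \<Rightarrow> ('b, 'a) tensor2 \<Rightarrow> ('b, 'a) tensor2" where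
  "tensor_map \<equiv> tmap UNIV UNIV"

context
  fixes F G
  assumes F: "endo_linear F" and G: "endo_linear G"
begin

lemma tensor_map_linear: "tensor_linear (tensor_map F G)"
  by (rule tmap_linear) (use F G in \<open>auto simp: linear_on_UNIV_iff\<close>)

lemma tensor_map_pure: "tensor_map F G (x \<otimes> y) = F x \<otimes> G y"
  by (rule tmap_pure) (use F G in \<open>auto simp: linear_on_UNIV_iff\<close>)

text \<open>The definition of equivalence of data applies \<open>tmap\<close> over several pairs of
  subspaces to maps that matter only there. If these maps are restrictions of endomorphisms of the
  whole space, every such expression becomes a \<open>tensor_map\<close>, and all tensors can be
  compared inside one calculus.\<close>

lemma tmap_eq_tensor_map:
  assumes "subspace S" "subspace T"
    and "\<And>x. x \<in> S \<Longrightarrow> F x = \<phi> x" "\<And>y. y \<in> T \<Longrightarrow> G y = \<psi> y" "t \<in> tspace S T"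
  shows "tmap S T \<phi> \<psi> t = tensor_map F G t"
proof -
  have lin: "linear_on scale scale S \<phi>"
    if "subspace S" "endo_linear F" "\<forall>x\<in>S. \<phi> x = F x" for S F \<phi>
    using that by (simp add: linear_on_def subspace_add subspace_scale Vector_Spaces.linear_iff)
  have l: "linear_on scale scale S \<phi>" "linear_on scale scale T \<psi>"
    using lin[OF assms(1) F] lin[OF assms(2) G] assms(3,4) by simp_all
  show ?thesis
    by (rule tensor_eqI[OF tmap_linear[OF assms(1,2) l] tensor_map_linear _ assms(5)])
      (simp add: tmap_pure[OF assms(1,2) l] tensor_map_pure assms)
qed

lemma tensor_map_in_tspace:
  assumes "\<And>x. x \<in> S \<Longrightarrow> F x \<in> S'" "\<And>y. y \<in> T \<Longrightarrow> G y \<in> T'" "t \<in> tspace S T"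
  shows "tensor_map F G t \<in> tspace S' T'"
proof -
  interpret L: Vector_Spaces.linear tensor_scale tensor_scale "tensor_map F G"
    by (rule tensor_map_linear)
  have "t \<in> {t. tensor_map F G t \<in> tspace S' T'}"
    using assms(3) unfolding tspace_span[of S T]
    by (rule L.vs1.span_induct)
      (use assms(1,2) tspace_subspace in \<open>auto simp: tensor_map_pure pure2_in_tspace
        intro!: L.subspace_vimage[unfolded vimage_def]\<close>)
  then show ?thesis by simp
qed

lemma tensor_map_eq_self:
  assumes "\<And>x. x \<in> S \<Longrightarrow> F x = x" "\<And>y. y \<in> T \<Longrightarrow> G y = y" "t \<in> tspace S T"
  shows "tensor_map F G t = t"
  by (rule tensor_eqI[OF tensor_map_linear tensor_linear_id _ assms(3), unfolded id_apply])
    (simp add: tensor_map_pure assms(1,2))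

text \<open>A vanishing factor kills every pure tensor of the block, hence its span. Together with
  \<open>tensor_map_eq_self\<close> this evaluates block projections.\<close>

lemma tensor_map_eq_zero:
  assumes "(\<forall>x\<in>S. F x = 0) \<or> (\<forall>y\<in>T. G y = 0)" "t \<in> tspace S T"
  shows "tensor_map F G t = 0"
  by (rule tensor_eqI[OF tensor_map_linear tensor_linear_zero _ assms(2)])
    (use assms(1) in \<open>auto simp: tensor_map_pure\<close>)

text \<open>The tensor type also contains functionals outside the span of the pure tensors. There
  \<open>flip\<close> and \<open>tensor_map\<close> are arbitrary linear extensions, hence the
  membership assumption.\<close>

lemma flip_tensor_map:
  assumes "t \<in> tspace UNIV UNIV"
  shows "flip (tensor_map F G t) = tensor_map G F (flip t)"
proof -
  \<comment> \<open>Within this context the general facts on \<open>tensor_map\<close> exist only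
    for the order \<open>F\<close>, \<open>G\<close>; the swapped order goes back to
    \<open>tmap_linear\<close> and \<open>tmap_pure\<close>.\<close>
  have l: "tensor_linear (tensor_map G F)"
    by (rule tmap_linear) (use F G in \<open>auto simp: linear_on_UNIV_iff\<close>)
  have "tensor_map G F (y \<otimes> x) = G y \<otimes> F x" for x y
    by (rule tmap_pure) (use F G in \<open>auto simp: linear_on_UNIV_iff\<close>)
  then have "(flip \<circ> tensor_map F G) t = (tensor_map G F \<circ> flip) t"
    by (intro tensor_eqI[OF tensor_linear_comp[OF flip_linear tensor_map_linear]
          tensor_linear_comp[OF l flip_linear] _ assms])
      (simp add: tensor_map_pure)
  then show ?thesis by simp
qed

end

lemma tensor_map_add:
  assumes "endo_linear F" "endo_linear F'"
    "endo_linear G" "t \<in> tspace UNIV UNIV"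
  shows tensor_map_add_left: "tensor_map (\<lambda>x. F x + F' x) G t = tensor_map F G t + tensor_map F' G t"
    and tensor_map_add_right: "tensor_map G (\<lambda>x. F x + F' x) t = tensor_map G F t + tensor_map G F' t"
proof -
  have l: "endo_linear (\<lambda>x. F x + F' x)"
    using assms(1,2) by (simp add: Vector_Spaces.linear_iff scale_right_distrib)
  show "tensor_map (\<lambda>x. F x + F' x) G t = tensor_map F G t + tensor_map F' G t"
    by (rule tensor_eqI[OF tensor_map_linear[OF l assms(3)]
          tensor_linear_add[OF tensor_map_linear[OF assms(1,3)] tensor_map_linear[OF assms(2,3)]]
          _ assms(4)])
      (simp add: tensor_map_pure l assms pure2_simps)
  show "tensor_map G (\<lambda>x. F x + F' x) t = tensor_map G F t + tensor_map G F' t"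
    by (rule tensor_eqI[OF tensor_map_linear[OF assms(3) l]
          tensor_linear_add[OF tensor_map_linear[OF assms(3,1)] tensor_map_linear[OF assms(3,2)]]
          _ assms(4)])
      (simp add: tensor_map_pure l assms pure2_simps)
qed

end


section \<open>Bialgebras on a direct sum\<close>

lemma linear_on_zero:
  fixes f :: "'a::ab_group_add \<Rightarrow> 'c::ab_group_add"
  assumes "linear_on sa sc S f" "0 \<in> S"
  shows "f 0 = 0"
  using assms unfolding linear_on_def by (metis add.right_neutral add_left_cancel)

lemma bilinear_on_zero:
  fixes b :: "'a::ab_group_add \<Rightarrow> 'b::ab_group_add \<Rightarrow> 'c::ab_group_add"
  assumes "bilinear_on sa sb sc S T b" "0 \<in> S" "0 \<in> T"
  shows "y \<in> T \<Longrightarrow> b 0 y = 0" "x \<in> S \<Longrightarrow> b x 0 = 0"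
  using assms linear_on_zero[of sa sc S "\<lambda>x. b x y"] linear_on_zero[of sb sc T "b x"]
  by (simp_all add: bilinear_on_def)

text \<open>The ambient type itself plays the role of E, so a structure on E is a structure on
  \<open>UNIV\<close>.\<close>

locale lie_bialgebra_complement = vector_space_char_0 scale
  for scale :: "'k::field_char_0 \<Rightarrow> 'e::ab_group_add \<Rightarrow> 'e" (infixr \<open>*s\<close> 75) +
  fixes g V :: "'e set" and br :: "'e \<Rightarrow> 'e \<Rightarrow> 'e" and d :: "'e \<Rightarrow> ('e, 'k) tensor2"
  assumes bialgebra: "lie_bialgebra_on g br d"
    and complement: "complementary g V"
begin

abbreviation P where "P \<equiv> component g V"
abbreviation Q where "Q \<equiv> component V g"

lemma subspace_g: "subspace g" and subspace_V: "subspace V"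
  using complement by (auto simp: complementary_def)

lemma zero_in [simp]: "0 \<in> g" "0 \<in> V"
  using subspace_g subspace_V by (auto simp: subspace_0)

lemma direct_sum_eq_iff:
  assumes "a \<in> g" "b \<in> g" "x \<in> V" "y \<in> V"
  shows "a + x = b + y \<longleftrightarrow> a = b \<and> x = y"
proof
  assume eq: "a + x = b + y"
  then have "a - b = y - x" by (simp add: algebra_simps)
  moreover have "a - b \<in> g" "y - x \<in> V"
    using assms by (auto intro: subspace_diff subspace_g subspace_V)
  ultimately have "a - b \<in> g \<inter> V" by simp
  with complement have "a - b = 0" by (auto simp: complementary_def)
  with eq show "a = b \<and> x = y" by simp
qed simp

lemma component_sum:
  assumes "a \<in> g" "x \<in> V"
  shows "P (a + x) = a" "Q (a + x) = x"
proof -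
  show "P (a + x) = a" unfolding component_def
    by (rule the_equality) (use assms direct_sum_eq_iff in auto)
  show "Q (a + x) = x" unfolding component_def
  proof (rule the_equality)
    fix y assume "y \<in> V \<and> (\<exists>b\<in>g. a + x = y + b)"
    then obtain b where "y \<in> V" "b \<in> g" "a + x = b + y" by (auto simp: add.commute)
    with assms show "y = x" by (simp add: direct_sum_eq_iff)
  qed (use assms in \<open>auto simp: add.commute\<close>)
qed

lemma component_in [simp]: "P u \<in> g" "Q u \<in> V"
  and component_add_self: "P u + Q u = u"
proof -
  obtain a x where "a \<in> g" "x \<in> V" "u = a + x"
    using complement unfolding complementary_def by blast
  then show "P u \<in> g" "Q u \<in> V" "P u + Q u = u" by (simp_all add: component_sum)
qed

lemma component_g [simp]: "a \<in> g \<Longrightarrow> P a = a" "a \<in> g \<Longrightarrow> Q a = 0"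
  using component_sum[of a 0] by simp_all

lemma component_V [simp]: "x \<in> V \<Longrightarrow> P x = 0" "x \<in> V \<Longrightarrow> Q x = x"
  using component_sum[of 0 x] by simp_all

lemma component_linear: "endo_linear P" "endo_linear Q"
proof -
  have "P (u + w) = P u + P w \<and> Q (u + w) = Q u + Q w" for u w
  proof -
    have "u + w = (P u + P w) + (Q u + Q w)"
      by (metis component_add_self add.assoc add.left_commute)
    moreover have "P u + P w \<in> g" "Q u + Q w \<in> V"
      by (auto intro: subspace_add subspace_g subspace_V)
    ultimately show ?thesis by (metis component_sum)
  qed
  moreover have "P (c *s u) = c *s P u \<and> Q (c *s u) = c *s Q u" for c u
  proof -
    have "c *s u = c *s P u + c *s Q u"
      by (simp add: component_add_self flip: scale_right_distrib)
    moreover have "c *s P u \<in> g" "c *s Q u \<in> V"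
      by (auto intro: subspace_scale subspace_g subspace_V)
    ultimately show ?thesis by (metis component_sum)
  qed
  ultimately show "endo_linear P" "endo_linear Q"
    by (simp_all add: Vector_Spaces.linear_iff vector_space_axioms)
qed

lemma component_add [simp]: "P (u + w) = P u + P w" "Q (u + w) = Q u + Q w"
  and component_scale [simp]: "P (c *s u) = c *s P u" "Q (c *s u) = c *s Q u"
  using component_linear by (simp_all add: Vector_Spaces.linear_iff)

lemmas component_tensor_map_simps =
  tensor_linearD[OF tensor_map_linear[OF component_linear(1) component_linear(1)]]
  tensor_linearD[OF tensor_map_linear[OF component_linear(1) component_linear(2)]]
  tensor_linearD[OF tensor_map_linear[OF component_linear(2) component_linear(1)]]
  tensor_linearD[OF tensor_map_linear[OF component_linear(2) component_linear(2)]]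

text \<open>\<open>P\<close> and \<open>Q\<close> are complementary projections, so each tensor
  product of two of them is the identity on its own block and zero on the other three. The
  projection \<open>tensor_map Q P\<close> is not listed: for a skew tensor the block of V \<otimes>
  g is minus the flip of that of g \<otimes> V.\<close>

lemma tensor_block:
  "t \<in> tspace g g \<Longrightarrow> tensor_map P P t = t" "t \<in> tspace g g \<Longrightarrow> tensor_map P Q t = 0"
  "t \<in> tspace g g \<Longrightarrow> tensor_map Q Q t = 0"
  "t \<in> tspace g V \<Longrightarrow> tensor_map P P t = 0" "t \<in> tspace g V \<Longrightarrow> tensor_map P Q t = t"
  "t \<in> tspace g V \<Longrightarrow> tensor_map Q Q t = 0"
  "t \<in> tspace V g \<Longrightarrow> tensor_map P P t = 0" "t \<in> tspace V g \<Longrightarrow> tensor_map P Q t = 0"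
  "t \<in> tspace V g \<Longrightarrow> tensor_map Q Q t = 0"
  "t \<in> tspace V V \<Longrightarrow> tensor_map P P t = 0" "t \<in> tspace V V \<Longrightarrow> tensor_map P Q t = 0"
  "t \<in> tspace V V \<Longrightarrow> tensor_map Q Q t = t"
  \<comment> \<open>\<open>fail\<close> acts on whatever \<open>simp\<close> leaves open, so an
    unsuitable rule is rejected and the next alternative is tried.\<close>
  by (erule tensor_map_eq_self[OF component_linear(1) component_linear(1), rotated 2]
      tensor_map_eq_self[OF component_linear(1) component_linear(2), rotated 2]
      tensor_map_eq_self[OF component_linear(2) component_linear(2), rotated 2]
      tensor_map_eq_zero[OF component_linear(1) component_linear(1), rotated]
      tensor_map_eq_zero[OF component_linear(1) component_linear(2), rotated]
      tensor_map_eq_zero[OF component_linear(2) component_linear(2), rotated]; simp; fail)+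

lemma tensor_map_sum:
  assumes "endo_linear F" "endo_linear G" "t \<in> tspace UNIV UNIV"
  shows "tensor_map (\<lambda>u. F u + G u) (\<lambda>u. F u + G u) t =
    tensor_map F F t + tensor_map F G t + tensor_map G F t + tensor_map G G t"
proof -
  have "endo_linear (\<lambda>u. F u + G u)"
    using assms(1,2) by (simp add: Vector_Spaces.linear_iff scale_right_distrib)
  with assms show ?thesis
    by (simp add: tensor_map_add_left tensor_map_add_right add_ac)
qed

text \<open>Expand the tensor square of \<open>P\<close> + \<open>Q\<close>, which is the identity
  map.\<close>

lemma tensor_decomposition:
  assumes "t \<in> tspace UNIV UNIV"
  shows "t = tensor_map P P t + tensor_map P Q t + tensor_map Q P t + tensor_map Q Q t"
proof -
  have "endo_linear (\<lambda>u. P u + Q u)"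
    by (simp add: component_add_self Vector_Spaces.linear_iff vector_space_axioms)
  then have "tensor_map (\<lambda>u. P u + Q u) (\<lambda>u. P u + Q u) t = t"
    using assms by (intro tensor_map_eq_self) (simp_all add: component_add_self)
  with tensor_map_sum[OF component_linear assms] show ?thesis by simp
qed

lemma br_props:
  assumes "a \<in> g" "b \<in> g"
  shows "br a b \<in> g" "br a 0 = 0" "br 0 a = 0"
proof -
  have "br \<in> g \<rightarrow> g \<rightarrow> g" "bilinear_on scale scale scale g g br"
    using bialgebra by (auto simp: lie_bialgebra_on_def lie_algebra_on_def)
  with assms show "br a b \<in> g" "br a 0 = 0" "br 0 a = 0"
    by (auto simp: bilinear_on_zero)
qed

lemma d_props:
  shows "a \<in> g \<Longrightarrow> d a \<in> tspace g g" "d 0 = 0" "linear_on scale tensor_scale g d"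
  using bialgebra linear_on_zero[of scale tensor_scale g d]
  by (auto simp: lie_bialgebra_on_def lie_coalgebra_on_def)


section \<open>Data and their bi-products\<close>

abbreviation B where "B \<equiv> unified_bracket g V br"
abbreviation D where "D \<equiv> unified_cobracket g V d"

context
  fixes \<Omega> assumes datum: "extending_datum g V \<Omega>"
begin

lemma datum_in:
  "x \<in> V \<Longrightarrow> a \<in> g \<Longrightarrow> ract \<Omega> x a \<in> V" "x \<in> V \<Longrightarrow> a \<in> g \<Longrightarrow> lact \<Omega> x a \<in> g"
  "x \<in> V \<Longrightarrow> y \<in> V \<Longrightarrow> cocycle \<Omega> x y \<in> g" "x \<in> V \<Longrightarrow> y \<in> V \<Longrightarrow> vbracket \<Omega> x y \<in> V"
  "x \<in> V \<Longrightarrow> Delta_E \<Omega> x \<in> tspace g V" "x \<in> V \<Longrightarrow> Delta_V \<Omega> x \<in> tspace g g"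
  "x \<in> V \<Longrightarrow> delta_V \<Omega> x \<in> tspace V V"
  using datum unfolding extending_datum_def by (auto simp: PiE_iff)

lemma datum_zero:
  "a \<in> g \<Longrightarrow> ract \<Omega> 0 a = 0" "x \<in> V \<Longrightarrow> ract \<Omega> x 0 = 0"
  "a \<in> g \<Longrightarrow> lact \<Omega> 0 a = 0" "x \<in> V \<Longrightarrow> lact \<Omega> x 0 = 0"
  "x \<in> V \<Longrightarrow> cocycle \<Omega> 0 x = 0" "x \<in> V \<Longrightarrow> cocycle \<Omega> x 0 = 0"
  "x \<in> V \<Longrightarrow> vbracket \<Omega> 0 x = 0" "x \<in> V \<Longrightarrow> vbracket \<Omega> x 0 = 0"
  "Delta_E \<Omega> 0 = 0" "Delta_V \<Omega> 0 = 0" "delta_V \<Omega> 0 = 0"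
  using datum unfolding extending_datum_def
  by (blast intro: bilinear_on_zero linear_on_zero zero_in)+

lemma unified_bracket_simps:
  "a \<in> g \<Longrightarrow> b \<in> g \<Longrightarrow> B \<Omega> a b = br a b"
  "x \<in> V \<Longrightarrow> a \<in> g \<Longrightarrow> B \<Omega> x a = lact \<Omega> x a + ract \<Omega> x a"
  "x \<in> V \<Longrightarrow> y \<in> V \<Longrightarrow> B \<Omega> x y = cocycle \<Omega> x y + vbracket \<Omega> x y"
  by (simp_all add: unified_bracket_def datum_zero br_props br_props(2)[OF zero_in(1) zero_in(1)])

lemma unified_cobracket_simps:
  "a \<in> g \<Longrightarrow> D \<Omega> a = d a"
  "x \<in> V \<Longrightarrow> D \<Omega> x = Delta_E \<Omega> x - flip (Delta_E \<Omega> x) + Delta_V \<Omega> x + delta_V \<Omega> x"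
  by (simp_all add: unified_cobracket_def datum_zero d_props flip_simps)

text \<open>The summands of bracket and co-bracket lie in different blocks. In particular the flip
  of \<open>Delta_E \<Omega> x\<close> lies in \<open>tspace V g\<close>, so
  \<open>tensor_map P Q\<close> retains \<open>Delta_E\<close> alone.\<close>

lemma datum_of_biproduct:
  "x \<in> V \<Longrightarrow> a \<in> g \<Longrightarrow> ract \<Omega> x a = Q (B \<Omega> x a)"
  "x \<in> V \<Longrightarrow> a \<in> g \<Longrightarrow> lact \<Omega> x a = P (B \<Omega> x a)"
  "x \<in> V \<Longrightarrow> y \<in> V \<Longrightarrow> cocycle \<Omega> x y = P (B \<Omega> x y)"
  "x \<in> V \<Longrightarrow> y \<in> V \<Longrightarrow> vbracket \<Omega> x y = Q (B \<Omega> x y)"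
  "x \<in> V \<Longrightarrow> Delta_E \<Omega> x = tensor_map P Q (D \<Omega> x)"
  "x \<in> V \<Longrightarrow> Delta_V \<Omega> x = tensor_map P P (D \<Omega> x)"
  "x \<in> V \<Longrightarrow> delta_V \<Omega> x = tensor_map Q Q (D \<Omega> x)"
  using datum_in flip_in_tspace[OF datum_in(5)]
  by (simp_all add: unified_bracket_simps unified_cobracket_simps tensor_block
      component_tensor_map_simps)

end

text \<open>By \<open>datum_of_biproduct\<close> the bi-product determines all seven maps on their
  domains; the extensional function spaces turn this agreement into equality of records.\<close>

lemma unified_biproduct_inj:
  assumes \<Omega>: "extending_datum g V \<Omega>" and \<Omega>': "extending_datum g V \<Omega>'"
    and eq: "unified_biproduct g V br d \<Omega> = unified_biproduct g V br d \<Omega>'"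
  shows "\<Omega> = \<Omega>'"
proof -
  have ext2: "f = f'" if "f \<in> S \<rightarrow>\<^sub>E T \<rightarrow>\<^sub>E U" "f' \<in> S \<rightarrow>\<^sub>E T \<rightarrow>\<^sub>E U" "\<And>x y. x \<in> S \<Longrightarrow> y \<in> T \<Longrightarrow> f x y = f' x y"
    for f f' :: "'e \<Rightarrow> 'e \<Rightarrow> 'e" and S T U
    by (rule PiE_ext[OF that(1,2)], rule PiE_ext[of _ T "\<lambda>_. U"]) (use that in auto)
  have "B \<Omega> = B \<Omega>'" "D \<Omega> = D \<Omega>'" using eq by (simp_all add: unified_biproduct_def)
  note eqs = datum_of_biproduct[OF \<Omega>] datum_of_biproduct[OF \<Omega>'] this
   have "ract \<Omega> = ract \<Omega>'"
    by (rule ext2[of _ V g V]) (use \<Omega> \<Omega>' in \<open>simp_all add: extending_datum_def eqs\<close>)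
  moreover have "lact \<Omega> = lact \<Omega>'"
    by (rule ext2[of _ V g g]) (use \<Omega> \<Omega>' in \<open>simp_all add: extending_datum_def eqs\<close>)
  moreover have "cocycle \<Omega> = cocycle \<Omega>'"
    by (rule ext2[of _ V V g]) (use \<Omega> \<Omega>' in \<open>simp_all add: extending_datum_def eqs\<close>)
  moreover have "vbracket \<Omega> = vbracket \<Omega>'"
    by (rule ext2[of _ V V V]) (use \<Omega> \<Omega>' in \<open>simp_all add: extending_datum_def eqs\<close>)
  moreover have "Delta_E \<Omega> = Delta_E \<Omega>'"
    by (rule PiE_ext[of _ V "\<lambda>_. tspace g V"]) (use \<Omega> \<Omega>' in \<open>simp_all add: extending_datum_def eqs\<close>)
  moreover have "Delta_V \<Omega> = Delta_V \<Omega>'"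
    by (rule PiE_ext[of _ V "\<lambda>_. tspace g g"]) (use \<Omega> \<Omega>' in \<open>simp_all add: extending_datum_def eqs\<close>)
  moreover have "delta_V \<Omega> = delta_V \<Omega>'"
    by (rule PiE_ext[of _ V "\<lambda>_. tspace V V"]) (use \<Omega> \<Omega>' in \<open>simp_all add: extending_datum_def eqs\<close>)
  ultimately show ?thesis by (intro datum.equality) auto
qed

text \<open>The candidate inverse of the bi-product construction, made of the blocks of a structure
  on E. The restricted abstractions provide the extensionality that \<open>extending_datum\<close>
  demands.\<close>

definition datum_of ::
  "('e \<Rightarrow> 'e \<Rightarrow> 'e) \<Rightarrow> ('e \<Rightarrow> ('e, 'k) tensor2) \<Rightarrow> ('e, 'k) datum"
where
  "datum_of bra cobra =
     \<lparr> ract = (\<lambda>x\<in>V. \<lambda>a\<in>g. Q (bra x a)), lact = (\<lambda>x\<in>V. \<lambda>a\<in>g. P (bra x a)),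
       cocycle = (\<lambda>x\<in>V. \<lambda>y\<in>V. P (bra x y)), vbracket = (\<lambda>x\<in>V. \<lambda>y\<in>V. Q (bra x y)),
       Delta_E = (\<lambda>x\<in>V. tensor_map P Q (cobra x)), Delta_V = (\<lambda>x\<in>V. tensor_map P P (cobra x)),
       delta_V = (\<lambda>x\<in>V. tensor_map Q Q (cobra x)) \<rparr>"

lemma lie_bialgebra_on_UNIV_D:
  assumes "lie_bialgebra_on UNIV bra cobra"
  shows "bra (u + v) w = bra u w + bra v w" "bra u (v + w) = bra u v + bra u w"
    "bra (c *s u) w = c *s bra u w" "bra u (c *s w) = c *s bra u w"
    "bra u w = - bra w u"
    "linear_on scale tensor_scale UNIV cobra"
    "cobra (u + v) = cobra u + cobra v" "cobra (c *s u) = tensor_scale c (cobra u)"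
    "flip (cobra u) = - cobra u" "cobra u \<in> tspace UNIV UNIV"
proof -
  have "bilinear_on scale scale scale UNIV UNIV bra" and alt: "\<And>u. bra u u = 0"
    using assms by (auto simp: lie_bialgebra_on_def lie_algebra_on_def)
  then have add: "bra (u + v) w = bra u w + bra v w" "bra u (v + w) = bra u v + bra u w" 
    and "bra (c *s u) w = c *s bra u w" "bra u (c *s w) = c *s bra u w" for u v w c
    by (simp_all add: bilinear_on_def linear_on_def)
  then show "bra (u + v) w = bra u w + bra v w" "bra u (v + w) = bra u v + bra u w"
    "bra (c *s u) w = c *s bra u w" "bra u (c *s w) = c *s bra u w" by auto
  have "bra u w + bra w u = 0"
    using alt[of "u + w"] unfolding add by (simp add: alt add.commute)
  then show "bra u w = - bra w u" by (simp add: eq_neg_iff_add_eq_0)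
  show l: "linear_on scale tensor_scale UNIV cobra" and "cobra u \<in> tspace UNIV UNIV"
    using assms by (auto simp: lie_bialgebra_on_def lie_coalgebra_on_def)
  then show "cobra (u + v) = cobra u + cobra v" "cobra (c *s u) = tensor_scale c (cobra u)"
    by (simp_all add: linear_on_def)
  have "cobra u = - flip (cobra u)"
    using assms unfolding lie_bialgebra_on_def lie_coalgebra_on_def by blast
  then show "flip (cobra u) = - cobra u" by (metis minus_minus)
qed

lemma extending_datum_datum_of:
  assumes "lie_bialgebra_on UNIV bra cobra"
  shows "extending_datum g V (datum_of bra cobra)"
proof -
  note b = lie_bialgebra_on_UNIV_D[OF assms]
  have sub: "x + y \<in> S" "c *s x \<in> S" if "subspace S" "x \<in> S" "y \<in> S" for S x y c
    using that by (auto intro: subspace_add subspace_scale)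
  show ?thesis
    unfolding extending_datum_def datum_of_def bilinear_on_def linear_on_def
    by (auto simp: b(1-4,7,8) sub subspace_g subspace_V component_tensor_map_simps
        intro!: tensor_map_in_tspace[OF _ _ _ _ b(10)] component_linear)
qed

text \<open>The datum omits the bracket on g x V and the co-bracket block in V \<otimes> g.
  Antisymmetry of the bracket restores the first, skew-symmetry of the co-bracket the second; the
  parts on \<open>g\<close> itself are given by \<open>br\<close> and \<open>d\<close>.\<close>

lemma unified_biproduct_datum_of:
  assumes bialg: "lie_bialgebra_on UNIV bra cobra"
    and sub: "\<And>a b. a \<in> g \<Longrightarrow> b \<in> g \<Longrightarrow> bra a b = br a b" "\<And>a. a \<in> g \<Longrightarrow> cobra a = d a"
  shows "unified_biproduct g V br d (datum_of bra cobra) = (bra, cobra)"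
proof -
  note b = lie_bialgebra_on_UNIV_D[OF bialg]
  have "B (datum_of bra cobra) u w = bra u w" for u w
  proof -
    have "bra u w = bra (P u + Q u) (P w + Q w)" by (simp add: component_add_self)
    also have "\<dots> = bra (P u) (P w) + bra (Q u) (P w) - bra (Q w) (P u) + bra (Q u) (Q w)"
      unfolding b(1,2) using b(5)[of "P u" "Q w"] by simp
    also have "\<dots> = br (P u) (P w) + (P (bra (Q u) (P w)) + Q (bra (Q u) (P w)))
        - (P (bra (Q w) (P u)) + Q (bra (Q w) (P u))) + (P (bra (Q u) (Q w)) + Q (bra (Q u) (Q w)))"
      by (simp add: component_add_self sub)
    finally have eq: "bra u w = \<dots>" .
    have "B (datum_of bra cobra) u w = \<dots>"
      by (simp add: unified_bracket_def datum_of_def Let_def algebra_simps)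
    with eq show ?thesis by simp
  qed
  moreover have "D (datum_of bra cobra) u = cobra u" for u
  proof -
    let ?t = "cobra (Q u)"
    have "tensor_map Q P ?t = - flip (tensor_map P Q ?t)"
      using flip_tensor_map[OF component_linear b(10)[of "Q u"]]
      by (simp add: b(9) component_tensor_map_simps)
    then have "tensor_map P Q ?t - flip (tensor_map P Q ?t) + tensor_map P P ?t + tensor_map Q Q ?t
        = tensor_map P P ?t + tensor_map P Q ?t + tensor_map Q P ?t + tensor_map Q Q ?t"
      by (simp add: algebra_simps)
    also have "\<dots> = ?t" by (rule tensor_decomposition[OF b(10), symmetric])
    finally have "D (datum_of bra cobra) u = d (P u) + ?t"
      by (simp add: unified_cobracket_def datum_of_def Let_def algebra_simps)
    moreover have "cobra u = d (P u) + ?t"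
      using b(7)[of "P u" "Q u"] by (simp add: component_add_self sub)
    ultimately show ?thesis by simp
  qed
  ultimately show ?thesis by (simp add: unified_biproduct_def fun_eq_iff)
qed

lemma bij_betw_unified_biproduct:
  "bij_betw (unified_biproduct g V br d) (LBI g V br d) (bialgebra_extensions g br d)"
  unfolding bij_betw_def
proof (intro conjI inj_onI subset_antisym subsetI)
  show "\<Omega> = \<Omega>'" if "\<Omega> \<in> LBI g V br d" "\<Omega>' \<in> LBI g V br d"
    "unified_biproduct g V br d \<Omega> = unified_biproduct g V br d \<Omega>'" for \<Omega> \<Omega>'
    using that by (auto simp: LBI_def intro: unified_biproduct_inj)
  show "M \<in> bialgebra_extensions g br d" if "M \<in> unified_biproduct g V br d ` LBI g V br d" for M
    using that bialgebra
    by (auto simp: LBI_def unified_biproduct_def bialgebra_extensions_def lie_sub_bialgebra_def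
        unified_bracket_simps unified_cobracket_simps)
  show "M \<in> unified_biproduct g V br d ` LBI g V br d" if "M \<in> bialgebra_extensions g br d" for M
  proof -
    obtain bra cobra where M: "M = (bra, cobra)" "lie_bialgebra_on UNIV bra cobra"
      "lie_sub_bialgebra g br d bra cobra"
      using \<open>M \<in> bialgebra_extensions g br d\<close> by (auto simp: bialgebra_extensions_def)
    have eq: "unified_biproduct g V br d (datum_of bra cobra) = M"
      using M by (simp add: lie_sub_bialgebra_def unified_biproduct_datum_of)
    with M have "datum_of bra cobra \<in> LBI g V br d"
      by (auto simp: LBI_def extending_datum_datum_of unified_biproduct_def)
    with eq show ?thesis by blast
  qed
qed

text \<open>Both arguments split along g \<oplus> V, so additivity reduces the claim to four blocks,
  and antisymmetry obtains g x V from V x g.\<close>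

lemma alternating_eqI:
  fixes T T' :: "'e \<Rightarrow> 'e \<Rightarrow> 'e"
  assumes T: "\<And>u v w. T (u + v) w = T u w + T v w" "\<And>u v w. T u (v + w) = T u v + T u w"
      "\<And>u w. T u w = - T w u"
    and T': "\<And>u v w. T' (u + v) w = T' u w + T' v w" "\<And>u v w. T' u (v + w) = T' u v + T' u w"
      "\<And>u w. T' u w = - T' w u"
    and eq: "\<And>a b. a \<in> g \<Longrightarrow> b \<in> g \<Longrightarrow> T a b = T' a b" "\<And>x a. x \<in> V \<Longrightarrow> a \<in> g \<Longrightarrow> T x a = T' x a"
      "\<And>x y. x \<in> V \<Longrightarrow> y \<in> V \<Longrightarrow> T x y = T' x y"
  shows "T u w = T' u w"
proof -
  have "T (P u) (Q w) = T' (P u) (Q w)"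
    using T(3)[of "P u" "Q w"] T'(3)[of "P u" "Q w"] by (simp add: eq)
  then have "T (P u + Q u) (P w + Q w) = T' (P u + Q u) (P w + Q w)"
    by (simp only: T(1,2) T'(1,2) eq component_in)
  then show ?thesis by (simp add: component_add_self)
qed

text \<open>Each of the three block projections retains exactly one summand on either side. In the
  application \<open>t2\<close> and \<open>s2\<close> are minus the flips of \<open>t1\<close> and
  \<open>s1\<close>, so their equality carries no information of its own.\<close>

lemma tensor_direct_sum_cancel:
  assumes t: "t1 \<in> tspace g V" "t2 \<in> tspace V g" "t3 \<in> tspace g g" "t4 \<in> tspace V V"
    and s: "s1 \<in> tspace g V" "s2 \<in> tspace V g" "s3 \<in> tspace g g" "s4 \<in> tspace V V"
    and eq: "t1 + t2 + t3 + t4 = s1 + s2 + s3 + s4"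
  shows "t1 = s1" "t3 = s3" "t4 = s4"
proof -
  have "tensor_map F G (t1 + t2 + t3 + t4) = tensor_map F G (s1 + s2 + s3 + s4)" for F G
    by (simp add: eq)
  from this[of P Q] this[of P P] this[of Q Q] show "t1 = s1" "t3 = s3" "t4 = s4"
    using t s by (simp_all add: component_tensor_map_simps tensor_block)
qed


section \<open>Isomorphisms stabilising the subalgebra\<close>

context
  fixes p q \<phi>
  assumes p: "p \<in> V \<rightarrow> g" and q: "q \<in> V \<rightarrow> V"
    and \<phi>: "endo_linear \<phi>" and \<phi>_g: "\<And>a. a \<in> g \<Longrightarrow> \<phi> a = a"
    and \<phi>_V: "\<And>x. x \<in> V \<Longrightarrow> \<phi> x = p x + q x"
begin

text \<open>\<open>\<phi>\<^sub>g\<close> extends both the identity of \<open>g\<close> and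
  \<open>p\<close> on \<open>V\<close>; \<open>\<phi>\<^sub>V\<close> extends \<open>q\<close> by
  zero on \<open>g\<close>. Hence these two endomorphisms suffice to express every
  \<open>tmap\<close> in \<open>datum_equiv_via\<close>.\<close>

abbreviation \<phi>\<^sub>g where "\<phi>\<^sub>g \<equiv> \<lambda>u. P (\<phi> u)"
abbreviation \<phi>\<^sub>V where "\<phi>\<^sub>V \<equiv> \<lambda>u. Q (\<phi> u)"

lemma pq_in [simp]: "x \<in> V \<Longrightarrow> p x \<in> g" "x \<in> V \<Longrightarrow> q x \<in> V"
  using p q by auto

lemma comp_\<phi> [simp]: "a \<in> g \<Longrightarrow> \<phi>\<^sub>g a = a" "a \<in> g \<Longrightarrow> \<phi>\<^sub>V a = 0" "x \<in> V \<Longrightarrow> \<phi>\<^sub>g x = p x" "x \<in> V \<Longrightarrow> \<phi>\<^sub>V x = q x"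
  by (simp_all add: \<phi>_g \<phi>_V)

lemma comp_linear: "endo_linear \<phi>\<^sub>g" "endo_linear \<phi>\<^sub>V"
  using \<phi> by (simp_all add: Vector_Spaces.linear_iff)

lemma \<phi>_add: "\<phi> (u + w) = \<phi> u + \<phi> w"
  using \<phi> by (simp add: Vector_Spaces.linear_iff)

lemma \<phi>_minus: "\<phi> (- u) = - \<phi> u"
  using \<phi>_add[of u "- u"] \<phi>_g[of 0] by (simp add: eq_neg_iff_add_eq_0 add.commute)

lemma \<phi>_eq: "\<phi> u = (P u + p (Q u)) + q (Q u)"
  using \<phi>_add[of "P u" "Q u"] by (simp add: component_add_self \<phi>_g \<phi>_V add.assoc)

lemma component_\<phi>: "P (\<phi> u) = P u + p (Q u)" "Q (\<phi> u) = q (Q u)"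
proof -
  have "P u + p (Q u) \<in> g" by (simp add: subspace_add[OF subspace_g])
  then show "P (\<phi> u) = P u + p (Q u)" "Q (\<phi> u) = q (Q u)"
    unfolding \<phi>_eq by (rule component_sum; simp)+
qed

text \<open>With respect to g \<oplus> V the map \<open>\<phi>\<close> is block triangular with
  diagonal blocks the identity and \<open>q\<close>.\<close>

lemma bij_iff: "bij \<phi> \<longleftrightarrow> bij_betw q V V"
proof
  assume bij: "bij \<phi>"
  have "inj_on q V"
  proof (rule inj_onI)
    fix x y assume xy: "x \<in> V" "y \<in> V" "q x = q y"
    \<comment> \<open>Adding \<open>p y\<close> to \<open>x\<close> and \<open>p x\<close> to
      \<open>y\<close> gives both images the same component \<open>p x + p y\<close> in
      \<open>g\<close>.\<close>
    then have "\<phi> (p y + x) = \<phi> (p x + y)" by (simp add: \<phi>_add \<phi>_g \<phi>_V add_ac)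
    then have "p y + x = p x + y" using bij by (simp add: bij_def inj_eq)
    with xy show "x = y" by (simp add: direct_sum_eq_iff)
  qed
  moreover have "y \<in> q ` V" if y: "y \<in> V" for y
  proof -
    obtain u where "y = \<phi> u" using bij by (metis bij_pointE)
    with y have "y = Q (\<phi> u)" by simp
    also have "\<dots> = q (Q u)" by (rule component_\<phi>)
    finally show ?thesis by simp
  qed
  ultimately show "bij_betw q V V" by (auto simp: bij_betw_def)
next
  assume bij: "bij_betw q V V"
  show "bij \<phi>"
  proof (rule bijI)
    show "inj \<phi>"
    proof (rule injI)
      fix u w assume "\<phi> u = \<phi> w"
      then have eq: "P u + p (Q u) = P w + p (Q w)" "q (Q u) = q (Q w)"
        by (metis component_\<phi>(1), metis component_\<phi>(2))
      from eq(2) have "Q u = Q w"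
        by (rule inj_onD[OF bij_betw_imp_inj_on[OF bij]]) simp_all
      with eq(1) show "u = w" by (metis add_right_cancel component_add_self)
    qed
    show "surj \<phi>"
      unfolding surj_def
    proof (intro allI)
      fix y
      obtain x where x: "x \<in> V" "q x = Q y"
        using bij_betw_imp_surj_on[OF bij] component_in(2)[of y] by (metis imageE)
      \<comment> \<open>Subtracting \<open>p x\<close> compensates for the part in \<open>g\<close>
        that \<open>\<phi>\<close> adds to \<open>x\<close>.\<close>
      have "P y - p x \<in> g" using x by (simp add: subspace_diff subspace_g)
      then have "\<phi> (P y - p x + x) = y"
        using x component_add_self[of y] by (simp add: \<phi>_add \<phi>_g \<phi>_V)
      then show "\<exists>u. y = \<phi> u" by metis
    qed
  qed
qed

section \<open>Homomorphism equations in block form\<close>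

context
  fixes \<Omega> \<Omega>'
  assumes \<Omega>: "\<Omega> \<in> LBI g V br d" and \<Omega>': "\<Omega>' \<in> LBI g V br d"
begin

lemma data: "extending_datum g V \<Omega>" "extending_datum g V \<Omega>'"
  and bialgebras: "lie_bialgebra_on UNIV (B \<Omega>) (D \<Omega>)" "lie_bialgebra_on UNIV (B \<Omega>') (D \<Omega>')"
  using \<Omega> \<Omega>' by (auto simp: LBI_def)

text \<open>Compare the components in \<open>g\<close> and \<open>V\<close>. The new datum is
  evaluated at \<open>q x\<close>, so that no inverse of \<open>q\<close> enters before
  \<open>datum_equiv_via_iff\<close>.\<close>

lemma bracket_action_iff:
  assumes "x \<in> V" "a \<in> g"
  shows "\<phi> (B \<Omega> x a) = B \<Omega>' (\<phi> x) (\<phi> a) \<longleftrightarrow>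
    ract \<Omega>' (q x) a = q (ract \<Omega> x a) \<and>
    lact \<Omega>' (q x) a = p (ract \<Omega> x a) + lact \<Omega> x a - br (p x) a"
proof -
  note [simp] = assms datum_in[OF data(1)] datum_in[OF data(2)] br_props
  have "\<phi> (B \<Omega> x a) = (lact \<Omega> x a + p (ract \<Omega> x a)) + q (ract \<Omega> x a)"
    by (simp add: unified_bracket_simps[OF data(1)] \<phi>_add \<phi>_g \<phi>_V add.assoc)
  moreover have "B \<Omega>' (\<phi> x) (\<phi> a) = (br (p x) a + lact \<Omega>' (q x) a) + ract \<Omega>' (q x) a"
    by (simp add: unified_bracket_simps[OF data(2)] lie_bialgebra_on_UNIV_D(1)[OF bialgebras(2)]
        \<phi>_g \<phi>_V add.assoc)
  ultimately have "\<phi> (B \<Omega> x a) = B \<Omega>' (\<phi> x) (\<phi> a) \<longleftrightarrow>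
      (lact \<Omega> x a + p (ract \<Omega> x a)) + q (ract \<Omega> x a)
      = (br (p x) a + lact \<Omega>' (q x) a) + ract \<Omega>' (q x) a" by simp
  also have "\<dots> \<longleftrightarrow> lact \<Omega> x a + p (ract \<Omega> x a) = br (p x) a + lact \<Omega>' (q x) a
      \<and> q (ract \<Omega> x a) = ract \<Omega>' (q x) a"
    by (intro direct_sum_eq_iff) (auto intro!: subspace_add subspace_g)
  finally show ?thesis by (auto simp: algebra_simps)
qed

text \<open>Expanding the bracket of \<open>p x + q x\<close> and \<open>p y + q y\<close> yields
  mixed terms, which are actions of the new datum on \<open>p y\<close> and \<open>p x\<close>. The
  equations \<open>act\<close> express them through the old datum; then components are
  compared.\<close>

lemma bracket_V_iff:
  assumes act: "\<And>x a. x \<in> V \<Longrightarrow> a \<in> g \<Longrightarrow> ract \<Omega>' (q x) a = q (ract \<Omega> x a)"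
      "\<And>x a. x \<in> V \<Longrightarrow> a \<in> g \<Longrightarrow> lact \<Omega>' (q x) a = p (ract \<Omega> x a) + lact \<Omega> x a - br (p x) a"
    and xy: "x \<in> V" "y \<in> V"
  shows "\<phi> (B \<Omega> x y) = B \<Omega>' (\<phi> x) (\<phi> y) \<longleftrightarrow>
    cocycle \<Omega>' (q x) (q y) = cocycle \<Omega> x y + p (vbracket \<Omega> x y) + br (p x) (p y)
      - p (ract \<Omega> x (p y)) - lact \<Omega> x (p y) + p (ract \<Omega> y (p x)) + lact \<Omega> y (p x) \<and>
    vbracket \<Omega>' (q x) (q y) = q (vbracket \<Omega> x y) - q (ract \<Omega> x (p y)) + q (ract \<Omega> y (p x))"
    (is "_ \<longleftrightarrow> _ = ?c \<and> _ = ?v")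
proof -
  note [simp] = xy datum_in[OF data(1)] datum_in[OF data(2)] br_props
  \<comment> \<open>After substituting \<open>act\<close>, \<open>br (p x) (p y)\<close> occurs with
    both signs and cancels, while \<open>br (p y) (p x)\<close> remains and gives the bracket term
    of the cocycle equation. Its antisymmetry is inherited from \<open>B \<Omega>\<close>, which
    restricts to \<open>br\<close>.\<close>
  have anti: "br (p y) (p x) = - br (p x) (p y)"
    using lie_bialgebra_on_UNIV_D(5)[OF bialgebras(1), of "p y" "p x"]
    by (simp add: unified_bracket_simps[OF data(1)])
  have "B \<Omega>' (p x) (q y) = - B \<Omega>' (q y) (p x)"
    by (rule lie_bialgebra_on_UNIV_D(5)[OF bialgebras(2)])
  then have "B \<Omega>' (\<phi> x) (\<phi> y) = br (p x) (p y) - (lact \<Omega>' (q y) (p x) + ract \<Omega>' (q y) (p x))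
      + (lact \<Omega>' (q x) (p y) + ract \<Omega>' (q x) (p y))
      + (cocycle \<Omega>' (q x) (q y) + vbracket \<Omega>' (q x) (q y))"
    by (simp add: unified_bracket_simps[OF data(2)] lie_bialgebra_on_UNIV_D(1,2)[OF bialgebras(2)] \<phi>_V)
  moreover have "\<phi> (B \<Omega> x y) = cocycle \<Omega> x y + p (vbracket \<Omega> x y) + q (vbracket \<Omega> x y)"
    by (simp add: unified_bracket_simps[OF data(1)] \<phi>_add \<phi>_g \<phi>_V add.assoc)
  ultimately have "\<phi> (B \<Omega> x y) = B \<Omega>' (\<phi> x) (\<phi> y) \<longleftrightarrow>
      ?c + ?v = cocycle \<Omega>' (q x) (q y) + vbracket \<Omega>' (q x) (q y)"
    by (simp add: act anti) (auto simp: algebra_simps)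
  also have "\<dots> \<longleftrightarrow> ?c = cocycle \<Omega>' (q x) (q y) \<and> ?v = vbracket \<Omega>' (q x) (q y)"
    by (intro direct_sum_eq_iff)
      (auto intro!: subspace_add subspace_diff subspace_g subspace_V)
  finally show ?thesis by auto
qed

text \<open>On g x g both sides are \<open>br\<close>, since \<open>\<phi>\<close> fixes
  \<open>g\<close>, and g x V follows from V x g by antisymmetry. The equations on V x g are settled
  first because \<open>bracket_V_iff\<close> presupposes them.\<close>

lemma bracket_hom_iff:
  "(\<forall>u w. \<phi> (B \<Omega> u w) = B \<Omega>' (\<phi> u) (\<phi> w)) \<longleftrightarrow>
    (\<forall>x\<in>V. \<forall>a\<in>g. ract \<Omega>' (q x) a = q (ract \<Omega> x a) \<and>
      lact \<Omega>' (q x) a = p (ract \<Omega> x a) + lact \<Omega> x a - br (p x) a) \<and>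
    (\<forall>x\<in>V. \<forall>y\<in>V. cocycle \<Omega>' (q x) (q y) = cocycle \<Omega> x y + p (vbracket \<Omega> x y)
        + br (p x) (p y) - p (ract \<Omega> x (p y)) - lact \<Omega> x (p y)
        + p (ract \<Omega> y (p x)) + lact \<Omega> y (p x) \<and>
      vbracket \<Omega>' (q x) (q y) = q (vbracket \<Omega> x y) - q (ract \<Omega> x (p y)) + q (ract \<Omega> y (p x)))"
    (is "?hom \<longleftrightarrow> ?act \<and> ?VV")
proof
  assume hom: ?hom
  have act: ?act
    by (intro ballI bracket_action_iff[THEN iffD1]) (use hom in simp_all)
  have ?VV
  proof (intro ballI)
    fix x y assume xy: "x \<in> V" "y \<in> V"
    show "cocycle \<Omega>' (q x) (q y) = cocycle \<Omega> x y + p (vbracket \<Omega> x y)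
        + br (p x) (p y) - p (ract \<Omega> x (p y)) - lact \<Omega> x (p y)
        + p (ract \<Omega> y (p x)) + lact \<Omega> y (p x) \<and>
      vbracket \<Omega>' (q x) (q y) = q (vbracket \<Omega> x y) - q (ract \<Omega> x (p y)) + q (ract \<Omega> y (p x))"
      by (rule iffD1[OF bracket_V_iff[OF _ _ xy] hom[rule_format]])
        (simp_all only: act[rule_format])
  qed
  with act show "?act \<and> ?VV" by (rule conjI)
next
  assume eqs: "?act \<and> ?VV"
  note act = conjunct1[OF eqs] and VV = conjunct2[OF eqs]
  show ?hom
  proof (intro allI, rule alternating_eqI[of "\<lambda>u w. \<phi> (B \<Omega> u w)" "\<lambda>u w. B \<Omega>' (\<phi> u) (\<phi> w)"])
    show "\<phi> (B \<Omega> a b) = B \<Omega>' (\<phi> a) (\<phi> b)" if "a \<in> g" "b \<in> g" for a b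
      using that by (simp add: unified_bracket_simps[OF data(1)] unified_bracket_simps[OF data(2)]
          \<phi>_g br_props)
    show "\<phi> (B \<Omega> x a) = B \<Omega>' (\<phi> x) (\<phi> a)" if "x \<in> V" "a \<in> g" for x a
      by (rule iffD2[OF bracket_action_iff[OF that] act[rule_format, OF that]])
    show "\<phi> (B \<Omega> x y) = B \<Omega>' (\<phi> x) (\<phi> y)" if "x \<in> V" "y \<in> V" for x y
      by (rule iffD2[OF bracket_V_iff[OF _ _ that] VV[rule_format, OF that]])
        (simp_all only: act[rule_format])
    show "\<phi> (B \<Omega> u w) = - \<phi> (B \<Omega> w u)" for u w
      using lie_bialgebra_on_UNIV_D(5)[OF bialgebras(1), of u w] by (simp add: \<phi>_minus)
    show "B \<Omega>' (\<phi> u) (\<phi> w) = - B \<Omega>' (\<phi> w) (\<phi> u)" for u w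
      by (rule lie_bialgebra_on_UNIV_D(5)[OF bialgebras(2)])
  qed (simp_all add: \<phi>_add lie_bialgebra_on_UNIV_D(1,2)[OF bialgebras(1)]
      lie_bialgebra_on_UNIV_D(1,2)[OF bialgebras(2)])
qed

text \<open>
  The \<open>V \<otimes> g\<close> block yields no further condition: by skew-symmetry of \<open>\<delta>\<^sub>V\<close> it is minus the flip of
  the \<open>g \<otimes> V\<close> block.
\<close>

lemma cobracket_hom_V_iff:
  assumes x: "x \<in> V"
  shows "D \<Omega>' (\<phi> x) = tensor_map \<phi> \<phi> (D \<Omega> x) \<longleftrightarrow>
    delta_V \<Omega>' (q x) = tensor_map \<phi>\<^sub>V \<phi>\<^sub>V (delta_V \<Omega> x) \<and>
    Delta_E \<Omega>' (q x) = tensor_map \<phi>\<^sub>g \<phi>\<^sub>V (Delta_E \<Omega> x) + tensor_map \<phi>\<^sub>g \<phi>\<^sub>V (delta_V \<Omega> x) \<and>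
    Delta_V \<Omega>' (q x) = tensor_map \<phi>\<^sub>g \<phi>\<^sub>g (Delta_E \<Omega> x) - tensor_map \<phi>\<^sub>g \<phi>\<^sub>g (flip (Delta_E \<Omega> x))
      + tensor_map \<phi>\<^sub>g \<phi>\<^sub>g (delta_V \<Omega> x) + Delta_V \<Omega> x - d (p x)"
    (is "_ \<longleftrightarrow> _ = ?\<delta> \<and> _ = ?E \<and> _ = ?V")
proof -
  note in1 = datum_in[OF data(1)] and in2 = datum_in[OF data(2)]
  note lin = tensor_map_linear[OF comp_linear(1) comp_linear(1)] tensor_map_linear[OF comp_linear(1) comp_linear(2)]
    tensor_map_linear[OF comp_linear(2) comp_linear(1)] tensor_map_linear[OF comp_linear(2) comp_linear(2)]
  let ?Ex = "Delta_E \<Omega> x" and ?Vx = "Delta_V \<Omega> x" and ?\<delta>x = "delta_V \<Omega> x"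
  \<comment> \<open>\<open>\<phi>\<^sub>V\<close> vanishes on \<open>g\<close>, so of the four terms
    of \<open>tensor_map \<phi> \<phi>\<close> two survive on each mixed block and only one on
    \<open>tspace g g\<close>.\<close>
  have G0: "tensor_map \<phi>\<^sub>V F' t = 0" if "t \<in> tspace g T" "endo_linear F'" for F' t T
    by (rule tensor_map_eq_zero[OF comp_linear(2) that(2) _ that(1)]) simp
  have G0': "tensor_map F' \<phi>\<^sub>V t = 0" if "t \<in> tspace T g" "endo_linear F'" for F' t T
    by (rule tensor_map_eq_zero[OF that(2) comp_linear(2) _ that(1)]) simp
  have fE: "flip ?Ex \<in> tspace V g" using flip_in_tspace in1(5)[OF x] by blast
  have \<phi>FG: "tensor_map \<phi> \<phi> t =
      tensor_map \<phi>\<^sub>g \<phi>\<^sub>g t + tensor_map \<phi>\<^sub>g \<phi>\<^sub>V t + tensor_map \<phi>\<^sub>V \<phi>\<^sub>g t + tensor_map \<phi>\<^sub>V \<phi>\<^sub>V t"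
    if "t \<in> tspace S T" for t S T
  proof -
    have "\<phi> = (\<lambda>u. \<phi>\<^sub>g u + \<phi>\<^sub>V u)" by (simp add: component_add_self)
    with tensor_map_sum[OF comp_linear tspace_UNIV[OF that]] show ?thesis by simp
  qed
  have Vself: "tensor_map \<phi>\<^sub>g \<phi>\<^sub>g ?Vx = ?Vx"
    by (rule tensor_map_eq_self[OF comp_linear(1) comp_linear(1) _ _ in1(6)[OF x]]) simp_all
  \<comment> \<open>\<open>delta_V\<close> is the block \<open>tensor_map Q Q\<close> of a skew
    co-bracket, and this projection commutes with \<open>flip\<close>.\<close>
  have flip\<delta>: "flip ?\<delta>x = - ?\<delta>x"
    using flip_tensor_map[OF component_linear(2) component_linear(2)
        lie_bialgebra_on_UNIV_D(10)[OF bialgebras(1), of x]]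
    by (simp add: datum_of_biproduct(7)[OF data(1) x] lie_bialgebra_on_UNIV_D(9)[OF bialgebras(1)]
        component_tensor_map_simps)
  \<comment> \<open>The negative of this expression is the V \<otimes> g part of the image of
    \<open>D \<Omega> x\<close>.\<close>
  have flipE: "flip ?E = tensor_map \<phi>\<^sub>V \<phi>\<^sub>g (flip ?Ex) - tensor_map \<phi>\<^sub>V \<phi>\<^sub>g ?\<delta>x"
    using flip_tensor_map[OF comp_linear tspace_UNIV[OF in1(5)[OF x]]]
      flip_tensor_map[OF comp_linear tspace_UNIV[OF in1(7)[OF x]]]
    by (simp add: flip_simps flip\<delta> tensor_linearD[OF lin(3)])
  have "tensor_map \<phi> \<phi> (D \<Omega> x) =
      tensor_map \<phi> \<phi> ?Ex - tensor_map \<phi> \<phi> (flip ?Ex) + tensor_map \<phi> \<phi> ?Vx + tensor_map \<phi> \<phi> ?\<delta>x"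
    by (simp add: unified_cobracket_simps[OF data(1)] x tensor_linearD[OF tensor_map_linear[OF \<phi> \<phi>]])
  also have "\<dots> = (tensor_map \<phi>\<^sub>g \<phi>\<^sub>g ?Ex + tensor_map \<phi>\<^sub>g \<phi>\<^sub>V ?Ex)
      - (tensor_map \<phi>\<^sub>g \<phi>\<^sub>g (flip ?Ex) + tensor_map \<phi>\<^sub>V \<phi>\<^sub>g (flip ?Ex)) + ?Vx
      + (tensor_map \<phi>\<^sub>g \<phi>\<^sub>g ?\<delta>x + tensor_map \<phi>\<^sub>g \<phi>\<^sub>V ?\<delta>x + tensor_map \<phi>\<^sub>V \<phi>\<^sub>g ?\<delta>x + tensor_map \<phi>\<^sub>V \<phi>\<^sub>V ?\<delta>x)"
    using G0[OF in1(5)[OF x]] G0'[OF fE] G0[OF in1(6)[OF x]] G0'[OF in1(6)[OF x]] comp_linear Vself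
    by (simp add: \<phi>FG[OF in1(5)[OF x]] \<phi>FG[OF fE] \<phi>FG[OF in1(6)[OF x]] \<phi>FG[OF in1(7)[OF x]])
  \<comment> \<open>The term \<open>d (p x)\<close> is split off to match the left side, where the
    component \<open>p x\<close> of \<open>\<phi> x\<close> contributes exactly this; hence the
    \<open>- d (p x)\<close> inside \<open>?V\<close>.\<close>
  also have "\<dots> = d (p x) + (?E + (- flip ?E) + ?V + ?\<delta>)"
    unfolding flipE by (simp add: algebra_simps)
  finally have right: "tensor_map \<phi> \<phi> (D \<Omega> x) = d (p x) + (?E + (- flip ?E) + ?V + ?\<delta>)" .
  have left: "D \<Omega>' (\<phi> x) = d (p x) + (Delta_E \<Omega>' (q x) + (- flip (Delta_E \<Omega>' (q x)))
      + Delta_V \<Omega>' (q x) + delta_V \<Omega>' (q x))"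
    using x by (simp add: \<phi>_V lie_bialgebra_on_UNIV_D(7)[OF bialgebras(2)]
        unified_cobracket_simps[OF data(2)])
  interpret t: vector_space "tensor_scale :: 'k \<Rightarrow> ('e, 'k) tensor2 \<Rightarrow> _"
    by (rule vector_space_tensor_scale)
  note sub = t.subspace_add[OF tspace_subspace] t.subspace_diff[OF tspace_subspace]
    t.subspace_neg[OF tspace_subspace]
  have mem: "?E \<in> tspace g V" "?V \<in> tspace g g" "?\<delta> \<in> tspace V V"
    using x by (auto intro!: sub tensor_map_in_tspace[OF comp_linear _ _ in1(5)[OF x]]
        tensor_map_in_tspace[OF comp_linear _ _ in1(7)[OF x]]
        tensor_map_in_tspace[OF comp_linear(1) comp_linear(1) _ _ in1(5)[OF x]]
        tensor_map_in_tspace[OF comp_linear(1) comp_linear(1) _ _ fE]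
        tensor_map_in_tspace[OF comp_linear(1) comp_linear(1) _ _ in1(7)[OF x]]
        tensor_map_in_tspace[OF comp_linear(2) comp_linear(2) _ _ in1(7)[OF x]]
        in1(6) d_props(1))
  show ?thesis
  proof
    assume "D \<Omega>' (\<phi> x) = tensor_map \<phi> \<phi> (D \<Omega> x)"
    then have eq: "Delta_E \<Omega>' (q x) + (- flip (Delta_E \<Omega>' (q x))) + Delta_V \<Omega>' (q x) + delta_V \<Omega>' (q x)
        = ?E + (- flip ?E) + ?V + ?\<delta>"
      unfolding left right by (rule add_left_imp_eq)
    have qx: "q x \<in> V" using x by simp
    show "delta_V \<Omega>' (q x) = ?\<delta> \<and> Delta_E \<Omega>' (q x) = ?E \<and> Delta_V \<Omega>' (q x) = ?V"
      using tensor_direct_sum_cancel[OF in2(5)[OF qx] sub(3)[OF flip_in_tspace[OF in2(5)[OF qx]]]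
          in2(6)[OF qx] in2(7)[OF qx] mem(1) sub(3)[OF flip_in_tspace[OF mem(1)]] mem(2,3) eq]
      by blast
  next
    assume "delta_V \<Omega>' (q x) = ?\<delta> \<and> Delta_E \<Omega>' (q x) = ?E \<and> Delta_V \<Omega>' (q x) = ?V"
    then show "D \<Omega>' (\<phi> x) = tensor_map \<phi> \<phi> (D \<Omega> x)"
      unfolding left right by (elim conjE) (simp only:)
  qed
qed

text \<open>On \<open>g\<close> both co-brackets are \<open>d\<close>, with values in
  \<open>tspace g g\<close>, where \<open>tensor_map \<phi> \<phi>\<close> is the identity;
  additivity does the rest.\<close>

lemma cobracket_hom_iff:
  "(\<forall>u. D \<Omega>' (\<phi> u) = tensor_map \<phi> \<phi> (D \<Omega> u)) \<longleftrightarrow>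
    (\<forall>x\<in>V. D \<Omega>' (\<phi> x) = tensor_map \<phi> \<phi> (D \<Omega> x))"
proof (intro iffI allI)
  fix u assume V: "\<forall>x\<in>V. D \<Omega>' (\<phi> x) = tensor_map \<phi> \<phi> (D \<Omega> x)"
  have "tensor_map \<phi> \<phi> (d (P u)) = d (P u)"
    by (rule tensor_map_eq_self[OF \<phi> \<phi> _ _ d_props(1)]) (simp_all add: \<phi>_g)
  then have "D \<Omega>' (\<phi> (P u + Q u)) = tensor_map \<phi> \<phi> (D \<Omega> (P u + Q u))"
    using V by (simp add: \<phi>_add lie_bialgebra_on_UNIV_D(7)[OF bialgebras(1)]
        lie_bialgebra_on_UNIV_D(7)[OF bialgebras(2)] tensor_linearD[OF tensor_map_linear[OF \<phi> \<phi>]]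
        \<phi>_g unified_cobracket_simps(1)[OF data(1)] unified_cobracket_simps(1)[OF data(2)])
  then show "D \<Omega>' (\<phi> u) = tensor_map \<phi> \<phi> (D \<Omega> u)" by (simp add: component_add_self)
qed blast

text \<open>As \<open>q\<close> permutes \<open>V\<close>, each quantified variable may be replaced
  by its image under \<open>q\<close>. This removes \<open>inv_into\<close> and leaves the equations
  of the block lemmas.\<close>

lemma datum_equiv_via_iff:
  assumes bij: "bij_betw q V V"
  shows "datum_equiv_via g V br d p q \<Omega> \<Omega>' \<longleftrightarrow>
    (\<forall>u w. \<phi> (B \<Omega> u w) = B \<Omega>' (\<phi> u) (\<phi> w)) \<and> (\<forall>u. D \<Omega>' (\<phi> u) = tensor_map \<phi> \<phi> (D \<Omega> u))"
proof -
  have reindex: "(\<forall>x\<in>V. R x) \<longleftrightarrow> (\<forall>x\<in>V. R' x)" if "\<And>x. x \<in> V \<Longrightarrow> R (q x) \<longleftrightarrow> R' x" for R R'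
  proof -
    have "(\<forall>x\<in>V. R x) \<longleftrightarrow> (\<forall>x\<in>q ` V. R x)"
      by (simp only: bij_betw_imp_surj_on[OF bij])
    then show ?thesis using that by simp
  qed
  have inv: "inv_into V q (q x) = x" if "x \<in> V" for x
    using bij that by (rule bij_betw_inv_into_left)
  note tm = tmap_eq_tensor_map[OF comp_linear(1) comp_linear(1)] tmap_eq_tensor_map[OF comp_linear(1) comp_linear(2)]
    tmap_eq_tensor_map[OF comp_linear(2) comp_linear(2)]
  have t: "tmap V V q q (delta_V \<Omega> x) = tensor_map \<phi>\<^sub>V \<phi>\<^sub>V (delta_V \<Omega> x)"
    "tmap g V id q (Delta_E \<Omega> x) = tensor_map \<phi>\<^sub>g \<phi>\<^sub>V (Delta_E \<Omega> x)"
    "tmap V V p q (delta_V \<Omega> x) = tensor_map \<phi>\<^sub>g \<phi>\<^sub>V (delta_V \<Omega> x)"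
    "tmap g V id p (Delta_E \<Omega> x) = tensor_map \<phi>\<^sub>g \<phi>\<^sub>g (Delta_E \<Omega> x)"
    "tmap V g p id (flip (Delta_E \<Omega> x)) = tensor_map \<phi>\<^sub>g \<phi>\<^sub>g (flip (Delta_E \<Omega> x))"
    "tmap V V p p (delta_V \<Omega> x) = tensor_map \<phi>\<^sub>g \<phi>\<^sub>g (delta_V \<Omega> x)" if "x \<in> V" for x
    using that datum_in(5,7)[OF data(1)] flip_in_tspace[OF datum_in(5)[OF data(1)]]
    by (auto intro!: tm simp: subspace_g subspace_V)
  show ?thesis
    unfolding datum_equiv_via_def Let_def bracket_hom_iff cobracket_hom_iff
    \<comment> \<open>\<open>datum_equiv_via\<close> lists the co-bracket equations first, the
      right-hand side the bracket equations.\<close>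
    by (rule trans[OF _ conj_commute], intro arg_cong2[of _ _ _ _ "(\<and>)"] reindex)
      (simp_all add: inv t cobracket_hom_V_iff)
qed

lemma lie_bialgebra_iso_iff:
  "lie_bialgebra_iso (unified_biproduct g V br d \<Omega>) (unified_biproduct g V br d \<Omega>') \<phi> \<longleftrightarrow>
    bij_betw q V V \<and> datum_equiv_via g V br d p q \<Omega> \<Omega>'"
  using datum_equiv_via_iff bij_iff \<phi> by (auto simp: lie_bialgebra_iso_def unified_biproduct_def)

end

end

section \<open>Comparison of the two relations and passage to quotients\<close>

lemma datum_rel_iff_extension_rel:
  assumes \<Omega>: "\<Omega> \<in> LBI g V br d" and \<Omega>': "\<Omega>' \<in> LBI g V br d"
  shows "(\<Omega>, \<Omega>') \<in> datum_rel g V br d \<longleftrightarrow>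
    (unified_biproduct g V br d \<Omega>, unified_biproduct g V br d \<Omega>') \<in> extension_rel g br d"
proof
  assume "(\<Omega>, \<Omega>') \<in> datum_rel g V br d"
  then obtain p q where p: "p \<in> V \<rightarrow> g" "linear_on scale scale V p"
    and q: "linear_on scale scale V q" "bij_betw q V V"
    and equiv: "datum_equiv_via g V br d p q \<Omega> \<Omega>'"
    by (auto simp: datum_rel_def)
  define \<phi> where "\<phi> u = P u + (p (Q u) + q (Q u))" for u
  have "q \<in> V \<rightarrow> V" using q(2) by (auto simp: bij_betw_def)
  moreover have "endo_linear \<phi>"
    using p(2) q(1) unfolding linear_on_def \<phi>_def Vector_Spaces.linear_iff
    by (simp add: vector_space_axioms scale_right_distrib add_ac)
  moreover have "\<phi> a = a" if "a \<in> g" for a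
    using that linear_on_zero[OF p(2)] linear_on_zero[OF q(1)] by (simp add: \<phi>_def)
  moreover have "\<phi> x = p x + q x" if "x \<in> V" for x
    using that by (simp add: \<phi>_def)
  ultimately have "lie_bialgebra_iso (unified_biproduct g V br d \<Omega>) (unified_biproduct g V br d \<Omega>') \<phi>"
    "\<forall>a\<in>g. \<phi> a = a"
    using lie_bialgebra_iso_iff[OF p(1) _ _ _ _ \<Omega> \<Omega>'] q(2) equiv by blast+
  then show "(unified_biproduct g V br d \<Omega>, unified_biproduct g V br d \<Omega>') \<in> extension_rel g br d"
    using \<Omega> \<Omega>' bij_betw_unified_biproduct by (auto simp: extension_rel_def bij_betw_def)
next
  assume "(unified_biproduct g V br d \<Omega>, unified_biproduct g V br d \<Omega>') \<in> extension_rel g br d"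
  then obtain \<phi>
    where iso: "lie_bialgebra_iso (unified_biproduct g V br d \<Omega>) (unified_biproduct g V br d \<Omega>') \<phi>"
      and \<phi>_g: "\<forall>a\<in>g. \<phi> a = a"
    by (auto simp: extension_rel_def)
  then have \<phi>: "endo_linear \<phi>" by (simp add: lie_bialgebra_iso_def unified_biproduct_def)
  let ?p = "\<lambda>x. P (\<phi> x)" and ?q = "\<lambda>x. Q (\<phi> x)"
  have "bij_betw ?q V V \<and> datum_equiv_via g V br d ?p ?q \<Omega> \<Omega>'"
    using lie_bialgebra_iso_iff[of ?p ?q \<phi>, OF _ _ \<phi> _ _ \<Omega> \<Omega>'] iso \<phi>_g
    by (simp add: component_add_self)
  moreover have "linear_on scale scale V ?p" "linear_on scale scale V ?q"
    using \<phi> by (simp_all add: linear_on_def Vector_Spaces.linear_iff)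
  moreover have "?p \<in> V \<rightarrow> g" by simp
  ultimately show "(\<Omega>, \<Omega>') \<in> datum_rel g V br d"
    using \<Omega> \<Omega>' unfolding datum_rel_def mem_Collect_eq case_prod_conv by blast
qed

end

text \<open>A quotient is the set of relational images of points. Corresponding relations make
  \<open>f\<close> carry the image of \<open>x\<close> onto that of \<open>f x\<close>, which gives
  surjectivity; injectivity holds because \<open>f\<close> is injective on \<open>A\<close> and all
  classes are subsets of \<open>A\<close>.\<close>

lemma bij_betw_quotient_image:
  assumes f: "bij_betw f A B" and R: "R \<subseteq> A \<times> A" and S: "S \<subseteq> B \<times> B"
    and RS: "\<And>x y. x \<in> A \<Longrightarrow> y \<in> A \<Longrightarrow> (x, y) \<in> R \<longleftrightarrow> (f x, f y) \<in> S"
  shows "\<And>x. x \<in> A \<Longrightarrow> f ` (R `` {x}) = S `` {f x}" and "bij_betw ((`) f) (A // R) (B // S)"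
proof -
  have B: "B = f ` A" and inj: "inj_on f A" using f by (auto simp: bij_betw_def)
  show img: "f ` (R `` {x}) = S `` {f x}" if "x \<in> A" for x
  proof
    show "f ` (R `` {x}) \<subseteq> S `` {f x}" using R RS that by blast
    show "S `` {f x} \<subseteq> f ` (R `` {x})" using S RS that unfolding B by blast
  qed
  have "inj_on ((`) f) (A // R)"
  proof (rule inj_onI)
    fix X Y assume "X \<in> A // R" "Y \<in> A // R" "f ` X = f ` Y"
    moreover from this have "X \<subseteq> A" "Y \<subseteq> A" using R by (auto simp: quotient_def)
    ultimately show "X = Y" using inj by (simp add: inj_on_image_eq_iff)
  qed
  moreover have "(`) f ` (A // R) = B // S"
    by (auto simp: quotient_def B img image_iff)
  ultimately show "bij_betw ((`) f) (A // R) (B // S)" by (simp add: bij_betw_def)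
qed

theorem theorem4p6:
  fixes scale :: "'k::field_char_0 \<Rightarrow> 'e::ab_group_add \<Rightarrow> 'e"
    and g V :: "'e set"
    and br :: "'e \<Rightarrow> 'e \<Rightarrow> 'e"
    and d :: "'e \<Rightarrow> ('e, 'k) tensor2"
  assumes "vector_space scale"
    and "vector_space_char_0.lie_bialgebra_on scale g br d"
    and "vector_space_char_0.complementary scale g V"
  shows "\<exists>\<Phi>.
    (\<forall>\<Omega> \<in> vector_space_char_0.LBI scale g V br d.
       \<Phi> (vector_space_char_0.datum_rel scale g V br d `` {\<Omega>}) =
       vector_space_char_0.extension_rel scale g br d `` {vector_space_char_0.unified_biproduct scale g V br d \<Omega>}) \<and>
    bij_betw \<Phi> (vector_space_char_0.HBI scale g V br d) (vector_space_char_0.BExtd scale g br d)"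
proof -
  \<comment> \<open>Characteristic 0 is part of the type class \<open>field_char_0\<close>, so the
    locale asks for no axiom beyond \<open>vector_space\<close>.\<close>
  interpret vector_space_char_0 scale using assms(1) by (rule vector_space_char_0.intro)
  interpret lie_bialgebra_complement scale g V br d
    using assms(2,3) by unfold_locales
  have "datum_rel g V br d \<subseteq> LBI g V br d \<times> LBI g V br d"
    "extension_rel g br d \<subseteq> bialgebra_extensions g br d \<times> bialgebra_extensions g br d"
    by (auto simp: datum_rel_def extension_rel_def)
  note quotient = bij_betw_quotient_image[OF bij_betw_unified_biproduct this datum_rel_iff_extension_rel]
  show ?thesis
    unfolding HBI_def BExtd_def
    by (intro exI[of _ "(`) (unified_biproduct g V br d)"] conjI ballI quotient)
qed

end
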